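(* Let $\{x_j\}_{j\geq 1}$ be an i.i.d. sequence of $\mathbb{R}\setminus\{0\}$-valued random variables such that \[ \mathbb{E}\left[\log\big(1+|x_1|\big)\right]<\infty,\qquad \mathbb{E}\left[\log\left(1+\frac{1}{|x_1|}\right)\right]<\infty, \] and \[ \mathbb{E}\left[\left(\log\left|1+\frac{x_2}{x_1}\right|\right)^2\right]<\infty . \] For $j\geq 1$ let \[ Y_j=\begin{bmatrix}1 & x_j\\ \frac{1}{x_j} & 1\end{bmatrix}, \] for $n\ge 1$ let $S_n=Y_n\cdots Y_2\cdot Y_1$, let $\|\cdot\|$ be a matrix norm, and let $\lambda:=\lim_{n\to\infty}\frac1n\mathbb{E}\big[\log\|S_n\|\big]$ be the Lyapunov exponent. Then, as $n\to\infty$, \[ \frac{1}{\sqrt{n}}\big(\log\left\| S_n\right\| -n\lambda\big)\ \text{ converges in law to }\ N(0,\sigma^2), \] where the variance has the explicit representation \[ \sigma^2=\mathbb{E}\left[\left(\log\left|1+\frac{x_2}{x_1}\right|\right)^2\right]+2\,\mathbb{E}\left[\log\left|1+\frac{x_2}{x_1}\right|\,\log\left|1+\frac{x_3}{x_2}\right|\right]-3\lambda^2 . \] Moreover, $\sigma^2=0$ if and only if the distribution of the $x_j$ takes one of the following three forms, where $0<p<1$ and $a\neq 0$ are arbitrary: (i) $\mathbb{P}(x_j=a)=1$; (ii) $\mathbb{P}(x_j=a)=p=1-\mathbb{P}\left(x_j=(-3-2\sqrt{2})a\right)$; (iii) $\mathbb{P}(x_j=a)=p=1-\mathbb{P}\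left(x_j=(-3+2\sqrt{2})a\right)$.
   Context: The convention $\log 0=-\infty$ (and $(-\infty)^2=\infty$) is used, so the finiteness of $\mathbb{E}[(\log|1+x_2/x_1|)^2]$ in particular requires $\mathbb{P}(x_2=-x_1)=0$. $N(0,\sigma^2)$ denotes a Gaussian random variable with mean $0$ and variance $\sigma^2$; when $\sigma^2=0$ it is the constant $0$. The Lyapunov exponent $\lambda=\lim_{n\to\infty}\frac1n\mathbb{E}[\log\|S_n\|]$ does not depend on the choice of matrix norm; in this setting it is given by $\lambda=\mathbb{E}\left[\log\left|1+\frac{x_2}{x_1}\right|\right]$. *)

theory Defs
  imports "HOL-Probability.Probability"
begin

(* Any norm on the vector space of square matrices; submultiplicativity is not required. *)
definition is_matrix_norm :: "(real^'n^'n \<Rightarrow> real) \<Rightarrow> bool" where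
  "is_matrix_norm N \<longleftrightarrow>
     (\<forall>A. 0 \<le> N A) \<and> (\<forall>A. N A = 0 \<longleftrightarrow> A = 0) \<and>
     (\<forall>c A. N (c *\<^sub>R A) = \<bar>c\<bar> * N A) \<and> (\<forall>A B. N (A + B) \<le> N A + N B)"

(* Logarithm on [0, \<infinity>) with log 0 = -\<infinity>, whereas ln 0 is a real number in the library.
   The two differ only at 0, so they are interchangeable wherever the argument is almost surely
   nonzero. *)
definition elog :: "real \<Rightarrow> ereal" where
  "elog t = (if t = 0 then -\<infinity> else ereal (ln t))"

lemma elog_abs_sq:
  "e2ennreal ((elog \<bar>t\<bar>)\<^sup>2) = (if t = 0 then \<infinity> else ennreal ((ln \<bar>t\<bar>)\<^sup>2))"
  by (simp add: elog_def power2_eq_square e2ennreal_infty flip: ennreal.abs_eq)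

definition Y_mat :: "real \<Rightarrow> real^2^2" where
  "Y_mat t = vector [vector [1, t], vector [1 / t, 1]]"

(* S_mat x n w = Y_n ** ... ** Y_1; the sequence is indexed from 1 and x 0 is never used. *)
primrec S_mat :: "(nat \<Rightarrow> 'a \<Rightarrow> real) \<Rightarrow> nat \<Rightarrow> 'a \<Rightarrow> real^2^2" where
  "S_mat x 0 \<omega> = mat 1"
| "S_mat x (Suc n) \<omega> = Y_mat (x (Suc n) \<omega>) ** S_mat x n \<omega>"

definition mean_log_growth ::
  "'a measure \<Rightarrow> (real^2^2 \<Rightarrow> real) \<Rightarrow> (nat \<Rightarrow> 'a \<Rightarrow> real) \<Rightarrow> nat \<Rightarrow> real" where
  "mean_log_growth M N x n = (1 / real n) * (\<integral>\<omega>. ln (N (S_mat x n \<omega>)) \<partial>M)"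

definition lyapunov_exponent ::
  "'a measure \<Rightarrow> (real^2^2 \<Rightarrow> real) \<Rightarrow> (nat \<Rightarrow> 'a \<Rightarrow> real) \<Rightarrow> real" where
  "lyapunov_exponent M N x = lim (mean_log_growth M N x)"

definition asymp_var ::
  "'a measure \<Rightarrow> (real^2^2 \<Rightarrow> real) \<Rightarrow> (nat \<Rightarrow> 'a \<Rightarrow> real) \<Rightarrow> real" where
  "asymp_var M N x =
     (\<integral>\<omega>. (ln \<bar>1 + x 2 \<omega> / x 1 \<omega>\<bar>)\<^sup>2 \<partial>M)
     + 2 * (\<integral>\<omega>. ln \<bar>1 + x 2 \<omega> / x 1 \<omega>\<bar> * ln \<bar>1 + x 3 \<omega> / x 2 \<omega>\<bar> \<partial>M)
     - 3 * (lyapunov_exponent M N x)\<^sup>2"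

(* The law N(0, v), parametrised by the variance v \<ge> 0; for v = 0 it is the point mass at 0. *)
definition centered_gaussian :: "real \<Rightarrow> real measure" where
  "centered_gaussian v =
     (if v = 0 then return borel 0 else density lborel (normal_density 0 (sqrt v)))"

end

theory Submission
  imports Defs "HOL-Real_Asymp.Real_Asymp"
begin

text \<open>Each \<open>Y\<^sub>j\<close> is the rank-one matrix with column \<open>(1, 1 / x\<^sub>j)\<close> and row \<open>(1, x\<^sub>j)\<close>, so \<open>S\<^sub>n\<close> is the
  product of the factors \<open>1 + x\<^sub>j\<^sub>+\<^sub>1 / x\<^sub>j\<close> times a matrix that depends on \<open>x\<^sub>1\<close> and \<open>x\<^sub>n\<close> only and whose
  log-norm is bounded in \<open>L\<^sup>1\<close>. Hence \<open>ln \<parallel>S\<^sub>n\<parallel>\<close> is, up to an \<open>L\<^sup>1\<close>-bounded error, a sum of the stationary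
  1-dependent variables \<open>ln \<bar>1 + x\<^sub>j\<^sub>+\<^sub>1 / x\<^sub>j\<bar>\<close>. The central limit theorem for such a sum follows from
  the i.i.d. case by cutting it into blocks separated by gaps.

  With \<open>F(x, y) = ln \<bar>1 + y / x\<bar> - \<lambda>\<close> and \<open>a(x) = E F(x, x\<^sub>2)\<close>, the variance equals the second moment of
  \<open>F(x\<^sub>1, x\<^sub>2) - a(x\<^sub>1) + a(x\<^sub>2)\<close>. If it vanishes, then adding the equation \<open>F(x, y) = a(x) - a(y)\<close> to the
  one with x and y exchanged gives \<open>(x + y)\<^sup>2 = K \<bar>x y\<bar>\<close> almost surely. For fixed x this has finitely many
  solutions y, so the law is atomic, and comparing atoms leaves only the three listed forms.\<close>

section \<open>Moments and characteristic functions\<close>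

lemma integrable_mult_of_squares:
  fixes f g :: "'a \<Rightarrow> real"
  assumes [measurable]: "f \<in> borel_measurable M" "g \<in> borel_measurable M"
    and "integrable M (\<lambda>x. (f x)\<^sup>2)" "integrable M (\<lambda>x. (g x)\<^sup>2)"
  shows "integrable M (\<lambda>x. f x * g x)"
proof (rule Bochner_Integration.integrable_bound)
  show "integrable M (\<lambda>x. (f x)\<^sup>2 + (g x)\<^sup>2)"
    using assms by simp
  have "\<bar>a * b\<bar> \<le> a\<^sup>2 + b\<^sup>2" for a b :: real
    using sum_squares_bound[of "\<bar>a\<bar>" "\<bar>b\<bar>"] mult_nonneg_nonneg[of "\<bar>a\<bar>" "\<bar>b\<bar>"]
    unfolding abs_mult power2_abs by linarith
  then show "AE x in M. norm (f x * g x) \<le> norm ((f x)\<^sup>2 + (g x)\<^sup>2)"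
    by simp
qed simp

text \<open>The variance of \<open>\<bar>Y \<omega>\<bar>\<close> is nonnegative. This converts
  second-moment bounds on partial sums into L1 bounds.\<close>

lemma (in prob_space) expectation_abs_le_sqrt:
  fixes Y :: "'a \<Rightarrow> real"
  assumes [measurable]: "Y \<in> borel_measurable M" and sq: "integrable M (\<lambda>\<omega>. (Y \<omega>)\<^sup>2)"
  shows "expectation (\<lambda>\<omega>. \<bar>Y \<omega>\<bar>) \<le> sqrt (expectation (\<lambda>\<omega>. (Y \<omega>)\<^sup>2))"
proof -
  have "integrable M Y"
    using square_integrable_imp_integrable[OF assms] .
  then have "(expectation (\<lambda>\<omega>. \<bar>Y \<omega>\<bar>))\<^sup>2 \<le> expectation (\<lambda>\<omega>. (Y \<omega>)\<^sup>2)"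
    using variance_positive[of "\<lambda>\<omega>. \<bar>Y \<omega>\<bar>"] variance_eq[of "\<lambda>\<omega>. \<bar>Y \<omega>\<bar>"] sq by simp
  then show ?thesis
    by (simp add: real_le_rsqrt)
qed

text \<open>\<open>iexp\<close> is 1-Lipschitz on the real line. The errors in the central limit
  theorem below are discarded through this bound, so L1 estimates of differences suffice.\<close>

lemma (in prob_space) char_distr_diff_le:
  fixes Y Z :: "'a \<Rightarrow> real"
  assumes [measurable]: "Y \<in> borel_measurable M" "Z \<in> borel_measurable M"
    and int: "integrable M (\<lambda>\<omega>. Y \<omega> - Z \<omega>)"
  shows "cmod (char (distr M borel Y) t - char (distr M borel Z) t)
    \<le> \<bar>t\<bar> * expectation (\<lambda>\<omega>. \<bar>Y \<omega> - Z \<omega>\<bar>)"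
proof -
  have iexp_int: "integrable M (\<lambda>\<omega>. iexp (t * U \<omega>))" if [measurable]: "U \<in> borel_measurable M" for U
    by (rule integrable_const_bound[where B = 1]) auto
  have lip: "cmod (iexp a - iexp b) \<le> \<bar>a - b\<bar>" for a b :: real
  proof -
    have "iexp a - iexp b = iexp b * (iexp (a - b) - 1)"
      by (simp add: algebra_simps flip: exp_add)
    then show ?thesis
      using iexp_approx1[of "a - b" 0] by (simp add: norm_mult)
  qed
  have "char (distr M borel Y) t - char (distr M borel Z) t =
      (CLINT \<omega>|M. iexp (t * Y \<omega>) - iexp (t * Z \<omega>))"
    unfolding char_def Bochner_Integration.integral_diff[OF iexp_int iexp_int, OF assms(1,2)]
    by (simp add: integral_distr)
  also have "cmod \<dots> \<le> expectation (\<lambda>\<omega>. cmod (iexp (t * Y \<omega>) - iexp (t * Z \<omega>)))"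
    by (rule integral_norm_bound)
  also have "\<dots> \<le> expectation (\<lambda>\<omega>. \<bar>t\<bar> * \<bar>Y \<omega> - Z \<omega>\<bar>)"
  proof (rule integral_mono)
    show "integrable M (\<lambda>\<omega>. cmod (iexp (t * Y \<omega>) - iexp (t * Z \<omega>)))"
      by (intro integrable_norm Bochner_Integration.integrable_diff iexp_int assms(1,2))
    show "integrable M (\<lambda>\<omega>. \<bar>t\<bar> * \<bar>Y \<omega> - Z \<omega>\<bar>)"
      using int by simp
    show "cmod (iexp (t * Y \<omega>) - iexp (t * Z \<omega>)) \<le> \<bar>t\<bar> * \<bar>Y \<omega> - Z \<omega>\<bar>" for \<omega>
      using lip[of "t * Y \<omega>" "t * Z \<omega>"] by (simp only: abs_mult flip: right_diff_distrib)
  qed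
  finally show ?thesis
    by simp
qed

lemma real_distribution_centered_gaussian:
  assumes "0 \<le> v"
  shows "real_distribution (centered_gaussian v)"
proof (cases "v = 0")
  case True
  interpret prob_space "return borel (0::real)"
    by (rule prob_space_return) simp
  show ?thesis
    using True by (simp add: centered_gaussian_def real_distribution_def real_distribution_axioms_def
        prob_space_axioms)
next
  case False
  interpret prob_space "density lborel (normal_density 0 (sqrt v))"
    by (rule prob_space_normal_density) (use False assms in simp)
  show ?thesis
    using False by (simp add: centered_gaussian_def real_distribution_def real_distribution_axioms_def
        prob_space_axioms)
qed

lemma char_centered_gaussian:
  assumes "0 \<le> v"
  shows "char (centered_gaussian v) t = complex_of_real (exp (- (v * t\<^sup>2) / 2))"
proof (cases "v = 0")
  case True
  then show ?thesis
    by (simp add: centered_gaussian_def char_def integral_return)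
next
  case False
  then have v: "0 < sqrt v"
    using assms by simp
  interpret std: real_distribution std_normal_distribution
    by (rule real_dist_normal_dist)
  have "distributed std_normal_distribution lborel (\<lambda>x. x) std_normal_density"
    unfolding distributed_def by (simp add: distr_id2)
  from std.normal_density_affine[OF this, of "sqrt v" 0] v
  have "distr std_normal_distribution lborel (\<lambda>x. sqrt v * x) = density lborel (normal_density 0 (sqrt v))"
    by (simp add: distributed_distr_eq_density)
  \<comment> \<open>The affine image is given over \<open>lborel\<close>, which has the same sets as
    \<open>borel\<close>.\<close>
  moreover have "distr std_normal_distribution lborel (\<lambda>x. sqrt v * x)
      = distr std_normal_distribution borel (\<lambda>x. sqrt v * x)"
    by (intro distr_cong) auto
  ultimately have "centered_gaussian v = distr std_normal_distribution borel (\<lambda>x. sqrt v * x)"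
    using False by (simp add: centered_gaussian_def)
  then have "char (centered_gaussian v) t = char std_normal_distribution (sqrt v * t)"
    by (simp add: char_def integral_distr mult_ac)
  also have "\<dots> = complex_of_real (exp (- (v * t\<^sup>2) / 2))"
    using assms by (simp add: char_std_normal_distribution power_mult_distrib)
  finally show ?thesis .
qed

lemma const_over_sqrt_tendsto_0: "(\<lambda>n. a / sqrt (real n)) \<longlonglongrightarrow> 0"
  by real_asymp

lemma (in prob_space) char_distr:
  assumes [measurable]: "Y \<in> borel_measurable M"
  shows "char (distr M borel Y) t = (CLINT \<omega>|M. iexp (t * Y \<omega>))"
  by (simp add: char_def integral_distr)

text \<open>Rounding \<open>n\<close> down to a multiple of the block length \<open>m\<close> loses
  fewer than \<open>m\<close> terms, hence nothing in the limit.\<close>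

lemma div_mult_ratio_tendsto_1:
  assumes "0 < m"
  shows "(\<lambda>n. real (n div m * m) / real n) \<longlonglongrightarrow> 1"
proof (rule tendsto_sandwich)
  show "(\<lambda>n. 1 - real m * inverse (real n)) \<longlonglongrightarrow> 1"
    using tendsto_diff[OF tendsto_const tendsto_mult[OF tendsto_const lim_inverse_n], of 1 "real m"] by simp
  show "eventually (\<lambda>n. 1 - real m * inverse (real n) \<le> real (n div m * m) / real n) sequentially"
    using eventually_gt_at_top[of 0]
  proof eventually_elim
    case (elim n)
    have "n \<le> n div m * m + m"
      using mod_less_divisor[OF assms, of n] div_mult_mod_eq[of n m] by linarith
    then have "real n \<le> real (n div m * m) + real m"
      by (metis of_nat_add of_nat_le_iff)
    then have "(real n - real m) / real n \<le> real (n div m * m) / real n"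
      by (intro divide_right_mono) auto
    moreover have "(real n - real m) / real n = 1 - real m * inverse (real n)"
      using elim by (simp add: diff_divide_distrib) (simp add: divide_inverse)
    ultimately show ?case
      by simp
  qed
  show "eventually (\<lambda>n. real (n div m * m) / real n \<le> 1) sequentially"
    using eventually_gt_at_top[of 0]
  proof eventually_elim
    case (elim n)
    have "n div m * m \<le> n"
      by simp
    then have "real (n div m * m) \<le> real n"
      by (rule of_nat_mono)
    then show ?case
      using elim by simp
  qed
qed simp

section \<open>Functionals of consecutive pairs of an i.i.d. sequence\<close>

locale iid_sequence = prob_space M for M :: "'a measure" +
  fixes X :: "nat \<Rightarrow> 'a \<Rightarrow> real"
  assumes indep_X: "indep_vars (\<lambda>_. borel) X UNIV"
    and ident_X: "distr M borel (X j) = distr M borel (X 0)"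
begin

definition law :: "real measure" where
  "law = distr M borel (X 0)"

lemma X_measurable [measurable]: "X j \<in> borel_measurable M"
  using indep_X by (auto simp: indep_vars_def)

lemma distr_X: "distr M borel (X j) = law"
  unfolding law_def by (rule ident_X)

lemma sets_law [measurable_cong, simp]: "sets law = sets borel"
  by (simp add: law_def)

lemma space_law [simp]: "space law = UNIV"
  by (simp add: law_def)

lemma prob_space_law: "prob_space law"
  unfolding law_def by (rule prob_space_distr) simp

lemma distr_window:
  assumes "0 < m"
  shows "distr M (\<Pi>\<^sub>M i\<in>{..<m}. borel) (\<lambda>\<omega>. \<lambda>i\<in>{..<m}. X (k + i) \<omega>) = (\<Pi>\<^sub>M i\<in>{..<m}. law)"
proof -
  \<comment> \<open>The shift of the index passes through the singleton windows
    \<open>{k + i}\<close>, each followed by evaluation at its only coordinate.\<close>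
  have "indep_vars (\<lambda>i. PiM {k + i} (\<lambda>_. borel)) (\<lambda>i \<omega>. restrict (\<lambda>j. X j \<omega>) {k + i}) {..<m}"
    by (rule indep_vars_restrict[OF indep_X]) (auto simp: disjoint_family_on_def)
  from indep_vars_compose2[OF this, of "\<lambda>i f. f (k + i)" "\<lambda>_. borel"]
  have "indep_vars (\<lambda>_. borel) (\<lambda>i. X (k + i)) {..<m}"
    by simp
  then show ?thesis
    using assms by (subst (asm) indep_vars_iff_distr_eq_PiM') (auto simp: distr_X)
qed

text \<open>Stationarity in the form used below: both sides are the image of the same product law
  under \<open>g\<close>.\<close>

lemma distr_window_shift:
  assumes "0 < m" and [measurable]: "g \<in> measurable (\<Pi>\<^sub>M i\<in>{..<m}. borel) borel"
  shows "distr M borel (\<lambda>\<omega>. g (\<lambda>i\<in>{..<m}. X (k + i) \<omega>)) = distr M borel (\<lambda>\<omega>. g (\<lambda>i\<in>{..<m}. X i \<omega>))"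
proof -
  have "distr M borel (\<lambda>\<omega>. g (\<lambda>i\<in>{..<m}. X (k + i) \<omega>)) = distr (\<Pi>\<^sub>M i\<in>{..<m}. law) borel g" for k
    by (subst distr_window[OF assms(1), of k, symmetric]) (simp add: distr_distr comp_def)
  from this[of k] this[of 0] show ?thesis
    by simp
qed

lemma indep_var_windows:
  assumes "A \<inter> B = {}" "f \<in> measurable (PiM A (\<lambda>_. borel)) M1" "g \<in> measurable (PiM B (\<lambda>_. borel)) M2"
  shows "indep_var M1 (\<lambda>\<omega>. f (\<lambda>i\<in>A. X i \<omega>)) M2 (\<lambda>\<omega>. g (\<lambda>i\<in>B. X i \<omega>))"
  using indep_var_compose[OF indep_var_restrict[OF indep_X assms(1)] assms(2,3)]
  by (simp add: comp_def)

lemma distr_pair_X: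
  assumes "i \<noteq> j"
  shows "distr M (borel \<Otimes>\<^sub>M borel) (\<lambda>\<omega>. (X i \<omega>, X j \<omega>)) = law \<Otimes>\<^sub>M law"
proof -
  have "indep_var borel (X i) borel (X j)"
    using indep_var_windows[of "{i}" "{j}" "\<lambda>f. f i" borel "\<lambda>f. f j" borel] assms by simp
  then show ?thesis
    by (simp add: indep_var_distribution_eq distr_X)
qed

text \<open>For the product of two consecutive pair functionals, Fubini is applied with the pair of
  \<open>X 0\<close> and \<open>X 1\<close> held fixed. Besides these only \<open>X 2\<close> occurs
  there; \<open>X 3\<close> pads the second factor, so that both factors are
  \<open>law \<Otimes>\<^sub>M law\<close>.\<close>

lemma distr_quadruple_X:
  "distr M ((borel \<Otimes>\<^sub>M borel) \<Otimes>\<^sub>M (borel \<Otimes>\<^sub>M borel)) (\<lambda>\<omega>. ((X 0 \<omega>, X 1 \<omega>), (X 2 \<omega>, X 3 \<omega>)))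
    = (law \<Otimes>\<^sub>M law) \<Otimes>\<^sub>M (law \<Otimes>\<^sub>M law)"
proof -
  have meas: "(\<lambda>f. (f i, f j)) \<in> (\<Pi>\<^sub>M k\<in>{i, j}. borel) \<rightarrow>\<^sub>M borel \<Otimes>\<^sub>M borel" for i j :: nat
    by measurable
  have "indep_var (borel \<Otimes>\<^sub>M borel) (\<lambda>\<omega>. (X 0 \<omega>, X 1 \<omega>)) (borel \<Otimes>\<^sub>M borel) (\<lambda>\<omega>. (X 2 \<omega>, X 3 \<omega>))"
    using indep_var_windows[OF _ meas meas, of 0 1 2 3] by simp
  then show ?thesis
    unfolding indep_var_distribution_eq by (simp add: distr_pair_X)
qed

sublocale law: prob_space law
  by (rule prob_space_law)

sublocale law_pair: pair_prob_space law law ..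

lemma AE_pair_law_iff:
  assumes [measurable]: "Measurable.pred (borel \<Otimes>\<^sub>M borel) (\<lambda>p. Q (fst p) (snd p))"
    and "i \<noteq> j"
  shows "(AE \<omega> in M. Q (X i \<omega>) (X j \<omega>)) \<longleftrightarrow> (AE x in law. AE y in law. Q x y)"
proof -
  have "(AE x in law. AE y in law. Q x y) \<longleftrightarrow> (AE p in law \<Otimes>\<^sub>M law. Q (fst p) (snd p))"
    by (rule law_pair.AE_pair_iff) measurable
  also have "\<dots> \<longleftrightarrow> (AE \<omega> in M. Q (X i \<omega>) (X j \<omega>))"
    unfolding distr_pair_X[OF assms(2), symmetric] by (subst AE_distr_iff) simp_all
  finally show ?thesis ..
qed

lemma AE_swap_pair_law:
  assumes [measurable]: "Measurable.pred (borel \<Otimes>\<^sub>M borel) (\<lambda>p. Q (fst p) (snd p))"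
    and "AE x in law. AE y in law. Q x y"
  shows "AE x in law. AE y in law. Q y x"
proof -
  have "{p \<in> space (law \<Otimes>\<^sub>M law). Q (fst p) (snd p)} \<in> sets (law \<Otimes>\<^sub>M law)"
    by measurable
  from law_pair.AE_commute[OF this] assms(2) show ?thesis
    by simp
qed

lemma integral_law_eq:
  fixes g :: "real \<Rightarrow> real"
  assumes [measurable]: "g \<in> borel_measurable borel"
  shows "(\<integral>t. g t \<partial>law) = expectation (\<lambda>\<omega>. g (X j \<omega>))"
  unfolding distr_X[of j, symmetric] by (simp add: integral_distr)

lemma integrable_law_iff:
  fixes g :: "real \<Rightarrow> real"
  assumes [measurable]: "g \<in> borel_measurable borel"
  shows "integrable law g \<longleftrightarrow> integrable M (\<lambda>\<omega>. g (X j \<omega>))"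
  unfolding distr_X[of j, symmetric] by (simp add: integrable_distr_eq)

lemma integral_law_pair_eq:
  fixes g :: "real \<times> real \<Rightarrow> real"
  assumes [measurable]: "g \<in> borel_measurable (borel \<Otimes>\<^sub>M borel)" and "i \<noteq> j"
  shows "(\<integral>p. g p \<partial>(law \<Otimes>\<^sub>M law)) = expectation (\<lambda>\<omega>. g (X i \<omega>, X j \<omega>))"
  unfolding distr_pair_X[OF assms(2), symmetric] by (simp add: integral_distr)

lemma integrable_law_pair_iff:
  fixes g :: "real \<times> real \<Rightarrow> real"
  assumes [measurable]: "g \<in> borel_measurable (borel \<Otimes>\<^sub>M borel)" and "i \<noteq> j"
  shows "integrable (law \<Otimes>\<^sub>M law) g \<longleftrightarrow> integrable M (\<lambda>\<omega>. g (X i \<omega>, X j \<omega>))"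
  unfolding distr_pair_X[OF assms(2), symmetric] by (simp add: integrable_distr_eq)

end

section \<open>Covariances and partial sums of a stationary 1-dependent sequence\<close>

locale centered_pair_functional = iid_sequence +
  fixes F :: "real \<Rightarrow> real \<Rightarrow> real"
  assumes F_measurable [measurable]: "case_prod F \<in> borel_measurable (borel \<Otimes>\<^sub>M borel)"
    and F_square: "integrable M (\<lambda>\<omega>. (F (X 0 \<omega>) (X 1 \<omega>))\<^sup>2)"
    and F_mean: "expectation (\<lambda>\<omega>. F (X 0 \<omega>) (X 1 \<omega>)) = 0"
begin

definition z :: "nat \<Rightarrow> 'a \<Rightarrow> real" where
  "z j \<omega> = F (X j \<omega>) (X (Suc j) \<omega>)"

text \<open>The limit of the variance of n consecutive terms of \<open>z\<close> divided by n. Terms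
  at distance 2 or more are uncorrelated, so the covariance series stops after lag 1.\<close>

definition asymp_variance :: real where
  "asymp_variance = expectation (\<lambda>\<omega>. (z 0 \<omega>)\<^sup>2) + 2 * expectation (\<lambda>\<omega>. z 0 \<omega> * z 1 \<omega>)"

lemma z_measurable [measurable]: "z j \<in> borel_measurable M"
  unfolding z_def by measurable

lemma distr_z: "distr M borel (z j) = distr M borel (z 0)"
  using distr_window_shift[of 2 "\<lambda>f. F (f 0) (f 1)" j] by (simp add: z_def[abs_def])

lemma distr_z_mult: "distr M borel (\<lambda>\<omega>. z j \<omega> * z (Suc j) \<omega>) = distr M borel (\<lambda>\<omega>. z 0 \<omega> * z 1 \<omega>)"
  using distr_window_shift[of 3 "\<lambda>f. F (f 0) (f 1) * F (f 1) (f 2)" j]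
  by (simp add: z_def[abs_def] numeral_2_eq_2)

lemma z_square: "integrable M (\<lambda>\<omega>. (z j \<omega>)\<^sup>2)"
proof -
  have "integrable (distr M borel (z j)) (\<lambda>x. x\<^sup>2)"
    unfolding distr_z[of j] using F_square by (simp add: z_def[abs_def] integrable_distr_eq)
  then show ?thesis
    by (simp add: integrable_distr_eq)
qed

lemma z_integrable: "integrable M (z j)"
  by (rule square_integrable_imp_integrable[OF _ z_square]) simp

lemma z_mult_integrable: "integrable M (\<lambda>\<omega>. z i \<omega> * z j \<omega>)"
  by (rule integrable_mult_of_squares) (auto simp: z_square)

lemma expectation_z: "expectation (z j) = 0"
proof -
  have "expectation (z j) = (\<integral>x. x \<partial>distr M borel (z j))"
    by (simp add: integral_distr)
  also have "\<dots> = expectation (z 0)"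
    unfolding distr_z[of j] by (simp add: integral_distr)
  finally show ?thesis
    using F_mean by (simp add: z_def[abs_def])
qed

lemma expectation_z_square: "expectation (\<lambda>\<omega>. (z j \<omega>)\<^sup>2) = expectation (\<lambda>\<omega>. (z 0 \<omega>)\<^sup>2)"
proof -
  have "expectation (\<lambda>\<omega>. (z j \<omega>)\<^sup>2) = (\<integral>x. x\<^sup>2 \<partial>distr M borel (z j))"
    by (simp add: integral_distr)
  then show ?thesis
    unfolding distr_z[of j] by (simp add: integral_distr)
qed

lemma expectation_z_mult_Suc: "expectation (\<lambda>\<omega>. z j \<omega> * z (Suc j) \<omega>) = expectation (\<lambda>\<omega>. z 0 \<omega> * z 1 \<omega>)"
proof -
  have "expectation (\<lambda>\<omega>. z j \<omega> * z (Suc j) \<omega>) = (\<integral>x. x \<partial>distr M borel (\<lambda>\<omega>. z j \<omega> * z (Suc j) \<omega>))"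
    by (simp add: integral_distr)
  then show ?thesis
    unfolding distr_z_mult[of j] by (simp add: integral_distr)
qed

lemma expectation_z_mult_far:
  assumes "Suc i < j"
  shows "expectation (\<lambda>\<omega>. z i \<omega> * z j \<omega>) = 0"
proof -
  have "indep_var borel (z i) borel (z j)"
  proof -
    have "(\<lambda>f. F (f k) (f (Suc k))) \<in> borel_measurable (\<Pi>\<^sub>M i\<in>{k, Suc k}. borel)" for k
      by measurable
    from indep_var_windows[OF _ this this, of i j] assms show ?thesis
      by (simp add: z_def[abs_def])
  qed
  then show ?thesis
    by (subst indep_var_lebesgue_integral) (auto simp: z_integrable expectation_z)
qed

abbreviation (input) c0 :: real where
  "c0 \<equiv> expectation (\<lambda>\<omega>. (z 0 \<omega>)\<^sup>2)"

abbreviation (input) c1 :: real where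
  "c1 \<equiv> expectation (\<lambda>\<omega>. z 0 \<omega> * z 1 \<omega>)"

lemma sum_z_square_integrable: "integrable M (\<lambda>\<omega>. (\<Sum>i\<in>I. z (f i) \<omega>)\<^sup>2)"
  unfolding power2_eq_square sum_product
  by (intro Bochner_Integration.integrable_sum z_mult_integrable)

text \<open>Only the n + 1 diagonal terms and the 2 n terms next to the diagonal of the double sum
  survive. Counting \<open>Suc n\<close> summands avoids truncated subtraction.\<close>

lemma expectation_sum_z_square:
  "expectation (\<lambda>\<omega>. (\<Sum>i<Suc n. z (k + i) \<omega>)\<^sup>2) = (real n + 1) * c0 + 2 * real n * c1"
proof (induction n)
  case 0
  then show ?case
    by (simp add: expectation_z_square[of k])
next
  case (Suc n)
  let ?W = "\<lambda>\<omega>. \<Sum>i<Suc n. z (k + i) \<omega>" and ?Z = "z (k + Suc n)"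
  \<comment> \<open>The new term is uncorrelated with all of the window but its last
    element.\<close>
  have WZ: "expectation (\<lambda>\<omega>. ?W \<omega> * ?Z \<omega>) = c1"
  proof -
    have "expectation (\<lambda>\<omega>. ?W \<omega> * ?Z \<omega>) = (\<Sum>i<Suc n. expectation (\<lambda>\<omega>. z (k + i) \<omega> * ?Z \<omega>))"
      unfolding sum_distrib_right by (intro Bochner_Integration.integral_sum z_mult_integrable)
    also have "\<dots> = (\<Sum>i<n. expectation (\<lambda>\<omega>. z (k + i) \<omega> * ?Z \<omega>)) + expectation (\<lambda>\<omega>. z (k + n) \<omega> * ?Z \<omega>)"
      by simp
    also have "\<dots> = c1"
      using expectation_z_mult_Suc[of "k + n"] by (simp add: expectation_z_mult_far)
    finally show ?thesis .
  qed
  have int: "integrable M (\<lambda>\<omega>. ?W \<omega> * ?Z \<omega>)"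
    unfolding sum_distrib_right by (intro Bochner_Integration.integrable_sum z_mult_integrable)
  have "expectation (\<lambda>\<omega>. (\<Sum>i<Suc (Suc n). z (k + i) \<omega>)\<^sup>2)
      = expectation (\<lambda>\<omega>. (?W \<omega>)\<^sup>2 + (?Z \<omega>)\<^sup>2 + 2 * (?W \<omega> * ?Z \<omega>))"
    by (subst sum.lessThan_Suc) (simp only: power2_sum mult.assoc)
  also have "\<dots> = expectation (\<lambda>\<omega>. (?W \<omega>)\<^sup>2) + c0 + 2 * c1"
    using int sum_z_square_integrable[where I = "{..<Suc n}" and f = "\<lambda>i. k + i"] z_square[of "k + Suc n"] WZ
    by (simp add: expectation_z_square[of "Suc (k + n)"] del: sum.lessThan_Suc)
  finally show ?case
    unfolding Suc.IH by (simp add: algebra_simps)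
qed

lemma expectation_abs_sum_z_le:
  "expectation (\<lambda>\<omega>. \<bar>\<Sum>i<n. z i \<omega>\<bar>) \<le> sqrt (real n * (c0 + 2 * \<bar>c1\<bar>))"
proof (cases n)
  case (Suc p)
  have "expectation (\<lambda>\<omega>. \<bar>\<Sum>i<n. z i \<omega>\<bar>) \<le> sqrt (expectation (\<lambda>\<omega>. (\<Sum>i<n. z i \<omega>)\<^sup>2))"
    using sum_z_square_integrable[where I = "{..<n}" and f = "\<lambda>i. i"] by (intro expectation_abs_le_sqrt) auto
  also have "\<dots> = sqrt ((real p + 1) * c0 + 2 * real p * c1)"
    using expectation_sum_z_square[of 0 p] Suc by (simp del: sum.lessThan_Suc)
  also have "\<dots> \<le> sqrt (real n * (c0 + 2 * \<bar>c1\<bar>))"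
  proof -
    have "real p * c1 \<le> (real p + 1) * \<bar>c1\<bar>"
    proof (rule order.trans)
      show "real p * c1 \<le> real p * \<bar>c1\<bar>"
        by (intro mult_left_mono) auto
    qed (simp add: algebra_simps)
    then show ?thesis
      using Suc by (simp add: algebra_simps)
  qed
  finally show ?thesis .
qed simp

text \<open>The blocking method: the partial sums are cut into blocks of \<^term>\<open>l\<close> consecutive terms
  separated by single gap terms, which makes the block sums independent.\<close>

definition block :: "nat \<Rightarrow> nat \<Rightarrow> 'a \<Rightarrow> real" where
  "block l k \<omega> = (\<Sum>i<l. z (k * Suc l + i) \<omega>)"

lemma block_measurable [measurable]: "block l k \<in> borel_measurable M"
  unfolding block_def by measurable

lemma sum_blocks:
  "(\<Sum>i<K * Suc l. z i \<omega>) = (\<Sum>k<K. block l k \<omega>) + (\<Sum>k<K. z (k * Suc l + l) \<omega>)"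
proof -
  have shift: "(\<Sum>i\<in>{a..<a + n}. z i \<omega>) = (\<Sum>i<n. z (a + i) \<omega>)" for a n
    using sum.atLeastLessThan_shift_0[of "\<lambda>i. z i \<omega>" a "a + n"] by (simp add: atLeast0LessThan)
  have "(\<Sum>i<K * Suc l. z i \<omega>) = (\<Sum>k<K. \<Sum>i\<in>{k * Suc l..<k * Suc l + Suc l}. z i \<omega>)"
    by (simp only: sum.nat_group)
  also have "\<dots> = (\<Sum>k<K. \<Sum>i<Suc l. z (k * Suc l + i) \<omega>)"
    by (rule sum.cong[OF refl]) (rule shift)
  also have "\<dots> = (\<Sum>k<K. block l k \<omega> + z (k * Suc l + l) \<omega>)"
    unfolding block_def by simp
  finally show ?thesis
    by (simp only: sum.distrib)
qed

lemma block_eq_window: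
  "block l k = (\<lambda>\<omega>. \<Sum>i<l. F ((\<lambda>i\<in>{..<Suc l}. X (k * Suc l + i) \<omega>) i) ((\<lambda>i\<in>{..<Suc l}. X (k * Suc l + i) \<omega>) (Suc i)))"
  by (auto simp: block_def z_def fun_eq_iff intro!: sum.cong)

lemma distr_block: "distr M borel (block l k) = distr M borel (block l 0)"
proof -
  have "(\<lambda>f. \<Sum>i<l. F (f i) (f (Suc i))) \<in> borel_measurable (\<Pi>\<^sub>M i\<in>{..<Suc l}. borel)"
    by (intro borel_measurable_sum measurable_compose[OF _ F_measurable[unfolded split_beta']]) measurable
  from distr_window_shift[OF _ this, of "k * Suc l"] show ?thesis
    unfolding block_eq_window by simp
qed

text \<open>Block k reads the variables with indices from k * (l + 1) to k * (l + 1) + l. Only the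
  gap term, which is left out, reaches into the index interval of the next block.\<close>

lemma indep_blocks: "indep_vars (\<lambda>_. borel) (block l) UNIV"
proof -
  define A where "A k = (\<lambda>i. k * Suc l + i) ` {..<Suc l}" for k
  have "disjoint_family_on A UNIV"
  proof -
    \<comment> \<open>The interval that contains an index is recovered by division, so distinct
      intervals are disjoint.\<close>
    have "i div Suc l = k" if "i \<in> A k" for i k
      using that div_mult_self1[of "Suc l" _ k] by (auto simp: A_def add.commute simp del: mult_Suc_right)
    then show ?thesis
      unfolding disjoint_family_on_def disjoint_iff by metis
  qed
  from indep_vars_restrict[OF indep_X _ this]
  have "indep_vars (\<lambda>k. PiM (A k) (\<lambda>_. borel)) (\<lambda>k \<omega>. \<lambda>i\<in>A k. X i \<omega>) UNIV"
    by simp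
  moreover have "(\<lambda>f. \<Sum>i<l. F (f (k * Suc l + i)) (f (k * Suc l + Suc i))) \<in> borel_measurable (PiM (A k) (\<lambda>_. borel))" for k
  proof (intro borel_measurable_sum)
    fix i assume "i \<in> {..<l}"
    then have "k * Suc l + i \<in> A k" "k * Suc l + Suc i \<in> A k"
      by (auto simp: A_def)
    then show "(\<lambda>f. F (f (k * Suc l + i)) (f (k * Suc l + Suc i))) \<in> borel_measurable (PiM (A k) (\<lambda>_. borel))"
      by measurable
  qed
  ultimately have "indep_vars (\<lambda>_. borel) (\<lambda>k \<omega>. \<Sum>i<l. F ((\<lambda>i\<in>A k. X i \<omega>) (k * Suc l + i)) ((\<lambda>i\<in>A k. X i \<omega>) (k * Suc l + Suc i))) UNIV"
    by (rule indep_vars_compose2)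
  also have "(\<lambda>k \<omega>. \<Sum>i<l. F ((\<lambda>i\<in>A k. X i \<omega>) (k * Suc l + i)) ((\<lambda>i\<in>A k. X i \<omega>) (k * Suc l + Suc i))) = block l"
    by (auto simp: block_def z_def fun_eq_iff A_def intro!: sum.cong)
  finally show ?thesis .
qed

lemma expectation_block: "expectation (block l k) = 0"
  unfolding block_def[abs_def] by (simp add: expectation_z z_integrable)

lemma expectation_block_square:
  "expectation (\<lambda>\<omega>. (block (Suc l) k \<omega>)\<^sup>2) = (real l + 1) * c0 + 2 * real l * c1"
  unfolding block_def by (rule expectation_sum_z_square)

text \<open>Successive gap terms are l + 1 >= 2 steps apart, hence uncorrelated, and their second
  moments add up.\<close>

lemma expectation_abs_sum_gaps_le:
  assumes "0 < l"
  shows "expectation (\<lambda>\<omega>. \<bar>\<Sum>k<K. z (k * Suc l + l) \<omega>\<bar>) \<le> sqrt (real K * c0)"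
proof -
  let ?g = "\<lambda>k. z (k * Suc l + l)"
  have far: "expectation (\<lambda>\<omega>. ?g i \<omega> * ?g j \<omega>) = 0" if "i < j" for i j
  proof -
    have "i * Suc l + Suc l \<le> j * Suc l"
      using mult_le_mono1[of "Suc i" j "Suc l"] that by simp
    then show ?thesis
      using assms by (intro expectation_z_mult_far) simp
  qed
  have gg: "expectation (\<lambda>\<omega>. ?g i \<omega> * ?g j \<omega>) = (if i = j then c0 else 0)" for i j
    using far[of i j] far[of j i] expectation_z_square[of "i * Suc l + l"]
    by (cases i j rule: linorder_cases) (auto simp: power2_eq_square mult.commute)
  have "expectation (\<lambda>\<omega>. (\<Sum>k<K. ?g k \<omega>)\<^sup>2) = (\<Sum>i<K. \<Sum>j<K. expectation (\<lambda>\<omega>. ?g i \<omega> * ?g j \<omega>))"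
    unfolding power2_eq_square sum_product
    by (simp only: Bochner_Integration.integral_sum Bochner_Integration.integrable_sum z_mult_integrable)
  also have "\<dots> = real K * c0"
    unfolding gg by simp
  finally show ?thesis
    using expectation_abs_le_sqrt[of "\<lambda>\<omega>. \<Sum>k<K. ?g k \<omega>"]
      sum_z_square_integrable[where I = "{..<K}" and f = "\<lambda>k. k * Suc l + l"]
    by simp
qed

text \<open>For a fixed block length the blocks are i.i.d., and the classical theorem applies once
  their variance is positive. Normalising by the number K * (l + 2) of original terms instead of by
  K times the block variance turns the argument t into \<open>sqrt v * t\<close>, where
  \<open>v\<close> is the block variance per original term.\<close>

lemma char_sum_blocks_limit:
  assumes pos: "0 < (real l + 1) * c0 + 2 * real l * c1"
  defines "v \<equiv> ((real l + 1) * c0 + 2 * real l * c1) / real (Suc (Suc l))"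
  shows "(\<lambda>K. char (distr M borel (\<lambda>\<omega>. (\<Sum>k<K. block (Suc l) k \<omega>) / sqrt (real (K * Suc (Suc l))))) t)
    \<longlonglongrightarrow> complex_of_real (exp (- (v * t\<^sup>2) / 2))"
proof -
  define V where "V = (real l + 1) * c0 + 2 * real l * c1"
  let ?S = "\<lambda>K \<omega>. \<Sum>k<K. block (Suc l) k \<omega>"
  have "0 < V" "v = V / real (Suc (Suc l))"
    using pos by (simp_all add: V_def v_def)
  have square: "integrable M (\<lambda>\<omega>. (block (Suc l) k \<omega>)\<^sup>2)" for k
    unfolding block_def by (rule sum_z_square_integrable)
  have "weak_conv_m (\<lambda>K. distr M borel (\<lambda>\<omega>. ?S K \<omega> / sqrt (real K * (sqrt V)\<^sup>2))) std_normal_distribution"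
    by (rule central_limit_theorem_zero_mean[OF indep_blocks _ _ square _ distr_block])
      (use \<open>0 < V\<close> in \<open>simp_all add: expectation_block expectation_block_square V_def del: real_sqrt_pow2_iff\<close>)
  then have "(\<lambda>K. char (distr M borel (\<lambda>\<omega>. ?S K \<omega> / sqrt (real K * V))) (sqrt v * t))
      \<longlonglongrightarrow> char std_normal_distribution (sqrt v * t)"
    using \<open>0 < V\<close>
    by (intro levy_continuity1 real_dist_normal_dist)
      (simp_all add: real_distribution_def real_distribution_axioms_def prob_space_distr)
  moreover have "char (distr M borel (\<lambda>\<omega>. ?S K \<omega> / sqrt (real K * V))) (sqrt v * t)
      = char (distr M borel (\<lambda>\<omega>. ?S K \<omega> / sqrt (real (K * Suc (Suc l))))) t" for K
  proof -
    have "sqrt v / sqrt (real K * V) = 1 / sqrt (real (K * Suc (Suc l)))"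
      using \<open>0 < V\<close> \<open>v = _\<close> unfolding of_nat_mult by (simp add: real_sqrt_divide real_sqrt_mult del: of_nat_Suc)
    then have scale: "sqrt v * t * (s / sqrt (real K * V)) = t * (s / sqrt (real (K * Suc (Suc l))))" for s
      by (metis (no_types, opaque_lifting) mult.assoc mult.commute mult.left_commute
          mult_1 times_divide_eq_right times_divide_eq_left)
    have "(\<lambda>\<omega>. ?S K \<omega> / c) \<in> borel_measurable M" for c
      by measurable
    then show ?thesis
      by (simp only: char_distr scale)
  qed
  moreover have "0 \<le> v"
    using \<open>0 < V\<close> \<open>v = _\<close> by simp
  ultimately show ?thesis
    by (simp add: char_std_normal_distribution power_mult_distrib)
qed

text \<open>The three summands bound, in order, the change of normalisation from n to K * m, the gap
  terms, and the fewer than m terms left at the end. For fixed m the first and the third tend to 0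
  as n grows; the second becomes small only for large m.\<close>

lemma scaled_sum_block_error:
  assumes "0 < l" "Suc l \<le> n"
  defines "m \<equiv> Suc l" and "K \<equiv> n div Suc l"
  shows "expectation (\<lambda>\<omega>. \<bar>(\<Sum>i<n. z i \<omega>) / sqrt n - (\<Sum>k<K. block l k \<omega>) / sqrt (real (K * m))\<bar>)
    \<le> sqrt (c0 + 2 * \<bar>c1\<bar>) * (1 - sqrt (real (K * m) / real n)) + sqrt (c0 / real m)
      + real m * expectation (\<lambda>\<omega>. \<bar>z 0 \<omega>\<bar>) / sqrt n"
proof -
  let ?W = "\<lambda>n \<omega>. \<Sum>i<n. z i \<omega>" and ?G = "\<lambda>\<omega>. \<Sum>k<K. z (k * m + l) \<omega>"
    and ?R = "\<lambda>\<omega>. \<Sum>i\<in>{K * m..<n}. z i \<omega>"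
  have "0 < K"
    using assms by (simp add: div_greater_zero_iff)
  have Km: "0 < K * m" "K * m \<le> n" "0 < n"
    using \<open>0 < K\<close> assms div_times_less_eq_dividend[of n "Suc l"] by (simp_all add: m_def K_def del: mult_Suc_right)
  define s where "s = 1 / sqrt (real (K * m))"
  define r where "r = 1 / sqrt (real n)"
  have rs: "0 < r" "r \<le> s" "0 < s"
    using Km by (auto simp: r_def s_def intro!: divide_left_mono real_sqrt_le_mono of_nat_mono simp del: of_nat_mult)
  have int: "integrable M (\<lambda>\<omega>. \<bar>?W (K * m) \<omega>\<bar>)" "integrable M (\<lambda>\<omega>. \<bar>?G \<omega>\<bar>)" "integrable M (\<lambda>\<omega>. \<Sum>i\<in>{K * m..<n}. \<bar>z i \<omega>\<bar>)"
    using z_integrable by auto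
  have "?W n \<omega> * r - (\<Sum>k<K. block l k \<omega>) * s = ?W (K * m) \<omega> * (r - s) + ?G \<omega> * s + ?R \<omega> * r" for \<omega>
  proof -
    have "?W n \<omega> = ?W (K * m) \<omega> + ?R \<omega>"
      using sum.atLeastLessThan_concat[where m = 0 and n = "K * m" and p = n and g = "\<lambda>i. z i \<omega>"] Km by (simp add: atLeast0LessThan)
    moreover have "(\<Sum>k<K. block l k \<omega>) = ?W (K * m) \<omega> - ?G \<omega>"
      using sum_blocks[where K = K and l = l and \<omega> = \<omega>] by (simp add: m_def)
    ultimately show ?thesis
      by (simp only:) (simp add: ring_distribs)
  qed
  moreover have "\<bar>w * (r - s) + g * s + q * r\<bar> \<le> (s - r) * \<bar>w\<bar> + s * \<bar>g\<bar> + r * \<bar>q\<bar>" for w g q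
  proof -
    have "\<bar>w * (r - s)\<bar> = (s - r) * \<bar>w\<bar>" "\<bar>g * s\<bar> = s * \<bar>g\<bar>" "\<bar>q * r\<bar> = r * \<bar>q\<bar>"
      using rs by (simp_all add: abs_mult)
    then show ?thesis
      by linarith
  qed
  ultimately have "\<bar>?W n \<omega> * r - (\<Sum>k<K. block l k \<omega>) * s\<bar>
      \<le> (s - r) * \<bar>?W (K * m) \<omega>\<bar> + s * \<bar>?G \<omega>\<bar> + r * \<bar>?R \<omega>\<bar>" for \<omega>
    by metis
  moreover have "r * \<bar>?R \<omega>\<bar> \<le> r * (\<Sum>i\<in>{K * m..<n}. \<bar>z i \<omega>\<bar>)" for \<omega>
    using rs by (intro mult_left_mono sum_abs) auto
  ultimately have "\<bar>?W n \<omega> * r - (\<Sum>k<K. block l k \<omega>) * s\<bar>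
      \<le> (s - r) * \<bar>?W (K * m) \<omega>\<bar> + s * \<bar>?G \<omega>\<bar> + r * (\<Sum>i\<in>{K * m..<n}. \<bar>z i \<omega>\<bar>)" for \<omega>
    by (meson add_left_mono order.trans)
  then have "expectation (\<lambda>\<omega>. \<bar>?W n \<omega> * r - (\<Sum>k<K. block l k \<omega>) * s\<bar>)
      \<le> expectation (\<lambda>\<omega>. (s - r) * \<bar>?W (K * m) \<omega>\<bar> + s * \<bar>?G \<omega>\<bar> + r * (\<Sum>i\<in>{K * m..<n}. \<bar>z i \<omega>\<bar>))"
    using int z_integrable by (intro integral_mono) (auto simp: block_def)
  also have "\<dots> = (s - r) * expectation (\<lambda>\<omega>. \<bar>?W (K * m) \<omega>\<bar>) + s * expectation (\<lambda>\<omega>. \<bar>?G \<omega>\<bar>)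
      + r * expectation (\<lambda>\<omega>. \<Sum>i\<in>{K * m..<n}. \<bar>z i \<omega>\<bar>)"
    using int by simp
  also have "\<dots> \<le> (s - r) * sqrt (real (K * m) * (c0 + 2 * \<bar>c1\<bar>)) + s * sqrt (real K * c0)
      + r * (real m * expectation (\<lambda>\<omega>. \<bar>z 0 \<omega>\<bar>))"
  proof (intro add_mono mult_left_mono)
    show "expectation (\<lambda>\<omega>. \<bar>?W (K * m) \<omega>\<bar>) \<le> sqrt (real (K * m) * (c0 + 2 * \<bar>c1\<bar>))"
      by (rule expectation_abs_sum_z_le)
    show "expectation (\<lambda>\<omega>. \<bar>?G \<omega>\<bar>) \<le> sqrt (real K * c0)"
      unfolding m_def by (rule expectation_abs_sum_gaps_le) fact
    have abs_z: "expectation (\<lambda>\<omega>. \<bar>z i \<omega>\<bar>) = expectation (\<lambda>\<omega>. \<bar>z 0 \<omega>\<bar>)" for i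
      using arg_cong[OF distr_z[of i], of "\<lambda>\<mu>. \<integral>x. \<bar>x\<bar> \<partial>\<mu>"] by (simp add: integral_distr)
    have "expectation (\<lambda>\<omega>. \<Sum>i\<in>{K * m..<n}. \<bar>z i \<omega>\<bar>) = (\<Sum>i\<in>{K * m..<n}. expectation (\<lambda>\<omega>. \<bar>z i \<omega>\<bar>))"
      using z_integrable by simp
    also have "\<dots> = real (n - K * m) * expectation (\<lambda>\<omega>. \<bar>z 0 \<omega>\<bar>)"
      by (subst sum.cong[OF refl abs_z]) simp
    also have "\<dots> \<le> real m * expectation (\<lambda>\<omega>. \<bar>z 0 \<omega>\<bar>)"
    proof (intro mult_right_mono of_nat_mono)
      show "n - K * m \<le> m"
        by (simp add: K_def m_def minus_div_mult_eq_mod less_imp_le del: mult_Suc_right)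
    qed simp
    finally show "expectation (\<lambda>\<omega>. \<Sum>i\<in>{K * m..<n}. \<bar>z i \<omega>\<bar>) \<le> real m * expectation (\<lambda>\<omega>. \<bar>z 0 \<omega>\<bar>)" .
  qed (use rs in auto)
  also have "(s - r) * sqrt (real (K * m) * (c0 + 2 * \<bar>c1\<bar>))
      = sqrt (c0 + 2 * \<bar>c1\<bar>) * (1 - sqrt (real (K * m) / real n))"
  proof -
    have "(1 / A - 1 / B) * (A * C) = C * (1 - A / B)" if "0 < A" "0 < B" for A B C :: real
      using that by (simp add: field_simps)
    then show ?thesis
      using Km unfolding s_def r_def real_sqrt_mult[of "real (K * m)"] real_sqrt_divide
      by (simp del: of_nat_mult)
  qed
  also have "s * sqrt (real K * c0) = sqrt (c0 / real m)"
    using \<open>0 < K\<close> unfolding s_def by (simp add: real_sqrt_mult real_sqrt_divide)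
  finally show ?thesis
    unfolding s_def r_def by (simp add: mult.commute)
qed

text \<open>Two limits in succession: first a block length is fixed for which the gap error and the
  defect of the block variance are small, then n tends to infinity. Zero limit variance is treated
  apart, since the block theorem asks for a positive block variance.\<close>

lemma char_scaled_sum_limit:
  assumes v: "0 \<le> asymp_variance"
  shows "(\<lambda>n. char (distr M borel (\<lambda>\<omega>. (\<Sum>i<n. z i \<omega>) / sqrt n)) t)
    \<longlonglongrightarrow> complex_of_real (exp (- (asymp_variance * t\<^sup>2) / 2))"
proof (cases "asymp_variance = 0")
  case True
  \<comment> \<open>If \<open>c0 + 2 * c1 = 0\<close>, the second moment of every nonempty partial
    sum is the constant \<open>- 2 * c1\<close>, and division by \<open>sqrt n\<close> sends the
    sums to 0 in L1.\<close>
  have "cmod (char (distr M borel (\<lambda>\<omega>. (\<Sum>i<n. z i \<omega>) / sqrt n)) t - 1) \<le> \<bar>t\<bar> * (sqrt (- 2 * c1) / sqrt n)" for n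
  proof (cases n)
    \<comment> \<open>Both sides are 0 here, as division by \<open>sqrt 0\<close> gives 0.\<close>
    case 0
    then show ?thesis
      by (simp add: char_def integral_distr prob_space del: distr_const)
  next
    case (Suc p)
    have "char (distr M borel (\<lambda>\<omega>. 0)) t = 1"
      by (simp add: char_def integral_distr prob_space del: distr_const)
    then have "cmod (char (distr M borel (\<lambda>\<omega>. (\<Sum>i<n. z i \<omega>) / sqrt n)) t - 1)
        \<le> \<bar>t\<bar> * expectation (\<lambda>\<omega>. \<bar>(\<Sum>i<n. z i \<omega>) / sqrt n - 0\<bar>)"
      using char_distr_diff_le[of "\<lambda>\<omega>. (\<Sum>i<n. z i \<omega>) / sqrt n" "\<lambda>\<omega>. 0" t] z_integrable by simp
    also have "\<dots> = \<bar>t\<bar> * (expectation (\<lambda>\<omega>. \<bar>\<Sum>i<n. z i \<omega>\<bar>) / sqrt n)"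
      by simp
    also have "expectation (\<lambda>\<omega>. \<bar>\<Sum>i<n. z i \<omega>\<bar>) \<le> sqrt (expectation (\<lambda>\<omega>. (\<Sum>i<n. z i \<omega>)\<^sup>2))"
      using sum_z_square_integrable[where I = "{..<n}" and f = "\<lambda>i. i"] by (intro expectation_abs_le_sqrt) auto
    also have "expectation (\<lambda>\<omega>. (\<Sum>i<n. z i \<omega>)\<^sup>2) = (real p + 1) * c0 + 2 * real p * c1"
      using expectation_sum_z_square[of 0 p] Suc by (simp del: sum.lessThan_Suc)
    also have "\<dots> = (real p + 1) * asymp_variance - 2 * c1"
      by (simp add: asymp_variance_def algebra_simps)
    also have "\<dots> = - 2 * c1"
      using True by simp
    finally show ?thesis
      by (simp add: mult_left_mono divide_right_mono)
  qed
  moreover have "(\<lambda>n. \<bar>t\<bar> * (sqrt (- 2 * c1) / sqrt (real n))) \<longlonglongrightarrow> 0"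
    by (rule tendsto_mult_right_zero[OF const_over_sqrt_tendsto_0])
  ultimately have "(\<lambda>n. char (distr M borel (\<lambda>\<omega>. (\<Sum>i<n. z i \<omega>) / sqrt n)) t - 1) \<longlonglongrightarrow> 0"
    by (rule Lim_null_comparison[OF always_eventually, rule_format])
  then show ?thesis
    using True by (simp add: LIM_zero_iff)
next
  case False
  define \<phi> where "\<phi> n = char (distr M borel (\<lambda>\<omega>. (\<Sum>i<n. z i \<omega>) / sqrt n)) t" for n
  define E :: "real \<Rightarrow> complex" where "E v = complex_of_real (exp (- (v * t\<^sup>2) / 2))" for v
  \<comment> \<open>\<open>w l\<close> is the block variance per original term for blocks of l + 1
    terms and one gap. Its two weights tend to 1.\<close>
  define w where "w l = ((real l + 1) * c0 + 2 * real l * c1) / real (Suc (Suc l))" for l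
  have "w \<longlonglongrightarrow> asymp_variance"
  proof -
    have "(\<lambda>l. ((real l + 1) / (real l + 2)) * c0 + 2 * (real l / (real l + 2)) * c1) \<longlonglongrightarrow> 1 * c0 + 2 * 1 * c1"
      by (intro tendsto_intros) real_asymp+
    moreover have "w = (\<lambda>l. ((real l + 1) / (real l + 2)) * c0 + 2 * (real l / (real l + 2)) * c1)"
    proof
      fix l
      have "real (Suc (Suc l)) = real l + 2"
        by simp
      then show "w l = ((real l + 1) / (real l + 2)) * c0 + 2 * (real l / (real l + 2)) * c1"
        unfolding w_def by (simp only: add_divide_distrib) (simp add: algebra_simps add_divide_distrib)
    qed
    ultimately show ?thesis
      unfolding asymp_variance_def by (simp only: mult_1 mult_1_right)
  qed
  then have E_lim: "(\<lambda>l. E (w l)) \<longlonglongrightarrow> E asymp_variance"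
    unfolding E_def by (intro tendsto_intros) auto
  have "\<phi> \<longlonglongrightarrow> E asymp_variance"
  proof (rule LIMSEQ_I)
    fix \<epsilon> :: real assume "0 < \<epsilon>"
    then have \<epsilon>: "0 < \<epsilon> / 3"
      by simp
    have "(\<lambda>l. c / real (Suc (Suc l))) \<longlonglongrightarrow> 0" for c :: real
      by real_asymp
    from tendsto_real_sqrt[OF this[of c0]]
    have gap_lim: "(\<lambda>l. \<bar>t\<bar> * sqrt (c0 / real (Suc (Suc l)))) \<longlonglongrightarrow> 0"
      by (intro tendsto_mult_right_zero) (simp only: real_sqrt_zero)
    \<comment> \<open>The limit is positive in this case, so blocks that are long enough satisfy the
      hypothesis of \<open>char_sum_blocks_limit\<close>.\<close>
    have "eventually (\<lambda>l. 0 < w l) sequentially"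
      using \<open>w \<longlonglongrightarrow> _\<close> v False by (intro order_tendstoD) auto
    moreover have "eventually (\<lambda>l. dist (E (w l)) (E asymp_variance) < \<epsilon> / 3) sequentially"
      by (rule tendstoD[OF E_lim \<epsilon>])
    moreover have "eventually (\<lambda>l. \<bar>t\<bar> * sqrt (c0 / real (Suc (Suc l))) < \<epsilon> / 3) sequentially"
      by (rule order_tendstoD(2)[OF gap_lim \<epsilon>])
    ultimately have "eventually (\<lambda>l. 0 < w l \<and> dist (E (w l)) (E asymp_variance) < \<epsilon> / 3 \<and>
        \<bar>t\<bar> * sqrt (c0 / real (Suc (Suc l))) < \<epsilon> / 3) sequentially"
      by eventually_elim simp
    then obtain l where l: "0 < w l" "dist (E (w l)) (E asymp_variance) < \<epsilon> / 3"
        "\<bar>t\<bar> * sqrt (c0 / real (Suc (Suc l))) < \<epsilon> / 3"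
      unfolding eventually_sequentially by blast
    define m where "m = Suc (Suc l)"
    define \<psi> where "\<psi> K = char (distr M borel (\<lambda>\<omega>. (\<Sum>k<K. block (Suc l) k \<omega>) / sqrt (real (K * m)))) t" for K
    define b where "b n = \<bar>t\<bar> * (sqrt (c0 + 2 * \<bar>c1\<bar>) * (1 - sqrt (real (n div m * m) / real n)) + sqrt (c0 / real m)
      + real m * expectation (\<lambda>\<omega>. \<bar>z 0 \<omega>\<bar>) / sqrt (real n))" for n
    have "\<psi> \<longlonglongrightarrow> E (w l)"
      using char_sum_blocks_limit[of l t] l(1) unfolding \<psi>_def E_def w_def m_def
      by (simp add: zero_less_divide_iff)
    moreover have "filterlim (\<lambda>n. n div m) sequentially sequentially"
      unfolding filterlim_at_top
    proof
      fix Z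
      show "eventually (\<lambda>n. Z \<le> n div m) sequentially"
        using eventually_ge_at_top[of "Z * m"]
      proof eventually_elim
        case (elim n)
        show ?case
          using div_le_mono[OF elim, of m] by (simp add: m_def del: mult_Suc_right)
      qed
    qed
    ultimately have "(\<lambda>n. \<psi> (n div m)) \<longlonglongrightarrow> E (w l)"
      by (rule filterlim_compose)
    then have \<psi>_close: "eventually (\<lambda>n. dist (\<psi> (n div m)) (E (w l)) < \<epsilon> / 3) sequentially"
      using \<epsilon> by (rule tendstoD)
    \<comment> \<open>The normalisation error and the remainder vanish in the limit. The gap error
      stays, and \<open>l\<close> was chosen to make it less than a third of
      \<open>\<epsilon>\<close>.\<close>
    have "b \<longlonglongrightarrow> \<bar>t\<bar> * (sqrt (c0 + 2 * \<bar>c1\<bar>) * (1 - sqrt 1) + sqrt (c0 / real m) + 0)"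
      unfolding b_def
    proof (intro tendsto_intros)
      show "(\<lambda>n. real (n div m * m) / real n) \<longlonglongrightarrow> 1"
        by (rule div_mult_ratio_tendsto_1) (simp add: m_def)
      show "(\<lambda>n. real m * expectation (\<lambda>\<omega>. \<bar>z 0 \<omega>\<bar>) / sqrt (real n)) \<longlonglongrightarrow> 0"
        by (rule const_over_sqrt_tendsto_0)
    qed
    then have b_small: "eventually (\<lambda>n. b n < \<epsilon> / 3) sequentially"
      using l(3) by (intro order_tendstoD(2)) (auto simp: m_def)
    have close: "cmod (\<phi> n - \<psi> (n div m)) \<le> b n" if "m \<le> n" for n
    proof -
      have "cmod (\<phi> n - \<psi> (n div m)) \<le> \<bar>t\<bar> * expectation (\<lambda>\<omega>. \<bar>(\<Sum>i<n. z i \<omega>) / sqrt n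
          - (\<Sum>k<n div m. block (Suc l) k \<omega>) / sqrt (real (n div m * m))\<bar>)"
        unfolding \<phi>_def \<psi>_def using z_integrable
        by (intro char_distr_diff_le) (auto simp: block_def)
      also have "\<dots> \<le> b n"
        unfolding b_def using scaled_sum_block_error[of "Suc l" n] that
        by (intro mult_left_mono) (auto simp: m_def)
      finally show ?thesis .
    qed
    have "eventually (\<lambda>n. norm (\<phi> n - E asymp_variance) < \<epsilon>) sequentially"
      using \<psi>_close b_small eventually_ge_at_top[of m]
    proof eventually_elim
      case (elim n)
      have "norm (\<phi> n - E asymp_variance) \<le> cmod (\<phi> n - \<psi> (n div m)) + dist (\<psi> (n div m)) (E (w l))
          + dist (E (w l)) (E asymp_variance)"
        using dist_triangle[of "\<phi> n" "E asymp_variance" "\<psi> (n div m)"]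
          dist_triangle[of "\<psi> (n div m)" "E asymp_variance" "E (w l)"]
        by (simp add: dist_norm)
      then show ?case
        using close[OF elim(3)] elim l(2) by linarith
    qed
    then show "\<exists>n0. \<forall>n\<ge>n0. norm (\<phi> n - E asymp_variance) < \<epsilon>"
      by (simp add: eventually_sequentially)
  qed
  then show ?thesis
    by (simp add: \<phi>_def[abs_def] E_def)
qed

text \<open>\<open>L n\<close> is meant to be the centred log-norm. An error that is bounded in L1
  is of order 1 / sqrt n after scaling.\<close>

theorem clt_of_L1_close_sums:
  fixes L :: "nat \<Rightarrow> 'a \<Rightarrow> real"
  assumes v: "0 \<le> asymp_variance"
    and [measurable]: "\<And>n. L n \<in> borel_measurable M"
    and int: "\<And>n. integrable M (\<lambda>\<omega>. L n \<omega> - (\<Sum>i<n. z i \<omega>))"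
    and B: "\<And>n. expectation (\<lambda>\<omega>. \<bar>L n \<omega> - (\<Sum>i<n. z i \<omega>)\<bar>) \<le> B"
  shows "weak_conv_m (\<lambda>n. distr M borel (\<lambda>\<omega>. L n \<omega> / sqrt n)) (centered_gaussian asymp_variance)"
proof (rule levy_continuity)
  show "real_distribution (distr M borel (\<lambda>\<omega>. L n \<omega> / sqrt n))" for n
    by (simp add: real_distribution_def real_distribution_axioms_def prob_space_distr)
  show "real_distribution (centered_gaussian asymp_variance)"
    by (rule real_distribution_centered_gaussian[OF v])
  fix t
  let ?\<phi> = "\<lambda>n. char (distr M borel (\<lambda>\<omega>. (\<Sum>i<n. z i \<omega>) / sqrt n)) t"
  let ?\<chi> = "\<lambda>n. char (distr M borel (\<lambda>\<omega>. L n \<omega> / sqrt n)) t"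
  have "cmod (?\<chi> n - ?\<phi> n) \<le> \<bar>t\<bar> * (B / sqrt n)" for n
  proof -
    have "cmod (?\<chi> n - ?\<phi> n) \<le> \<bar>t\<bar> * expectation (\<lambda>\<omega>. \<bar>L n \<omega> / sqrt n - (\<Sum>i<n. z i \<omega>) / sqrt n\<bar>)"
      using int[of n] by (intro char_distr_diff_le) (auto simp flip: diff_divide_distrib)
    also have "\<dots> = \<bar>t\<bar> * (expectation (\<lambda>\<omega>. \<bar>L n \<omega> - (\<Sum>i<n. z i \<omega>)\<bar>) / sqrt n)"
      by (simp flip: diff_divide_distrib)
    finally show ?thesis
      using mult_left_mono[OF divide_right_mono[OF B[of n], of "sqrt n"], of "\<bar>t\<bar>"] by simp
  qed
  moreover have "(\<lambda>n. \<bar>t\<bar> * (B / sqrt (real n))) \<longlonglongrightarrow> 0"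
    by (rule tendsto_mult_right_zero[OF const_over_sqrt_tendsto_0])
  ultimately have "(\<lambda>n. ?\<chi> n - ?\<phi> n) \<longlonglongrightarrow> 0"
    by (rule Lim_null_comparison[OF always_eventually, rule_format])
  from tendsto_add[OF this char_scaled_sum_limit[OF v, of t]]
  show "?\<chi> \<longlonglongrightarrow> char (centered_gaussian asymp_variance) t"
    by (simp add: char_centered_gaussian[OF v])
qed

section \<open>Martingale decomposition and the case of zero variance\<close>

definition potential :: "real \<Rightarrow> real" where
  "potential s = (\<integral>t. F s t \<partial>law)"

lemma potential_measurable [measurable]: "potential \<in> borel_measurable borel"
  unfolding potential_def[abs_def] by measurable

lemma F_law_pair_square: "integrable (law \<Otimes>\<^sub>M law) (\<lambda>p. (F (fst p) (snd p))\<^sup>2)"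
  by (subst integrable_law_pair_iff[OF _ zero_neq_one]) (use F_square in simp_all)

lemma F_law_pair: "integrable (law \<Otimes>\<^sub>M law) (\<lambda>p. F (fst p) (snd p))"
  by (rule law_pair.P.square_integrable_imp_integrable[OF _ F_law_pair_square]) measurable

lemma integral_potential: "(\<integral>s. potential s \<partial>law) = 0"
  using law_pair.integral_fst'[OF F_law_pair] integral_law_pair_eq[of "\<lambda>p. F (fst p) (snd p)" 0 1] F_mean
  by (simp add: potential_def[abs_def])

text \<open>Conditional Jensen: for almost every s the squared mean of \<open>F s\<close> is at most
  the mean of its square, and the latter is integrable in s by Fubini.\<close>

lemma potential_square_integrable: "integrable law (\<lambda>s. (potential s)\<^sup>2)"
proof (rule Bochner_Integration.integrable_bound)
  show "integrable law (\<lambda>s. \<integral>t. (F s t)\<^sup>2 \<partial>law)"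
    using law_pair.integrable_fst'[OF F_law_pair_square] by simp
  show "AE s in law. norm ((potential s)\<^sup>2) \<le> norm (\<integral>t. (F s t)\<^sup>2 \<partial>law)"
    using law_pair.AE_integrable_fst'[OF F_law_pair_square] law_pair.AE_integrable_fst'[OF F_law_pair]
  proof eventually_elim
    case (elim s)
    then show ?case
      using law.variance_positive[of "F s"] law.variance_eq[of "F s"] by (simp add: potential_def)
  qed
qed measurable

lemma potential_X_square: "integrable M (\<lambda>\<omega>. (potential (X j \<omega>))\<^sup>2)"
  using potential_square_integrable by (subst (asm) integrable_law_iff[of _ j]) simp_all

lemma z0_potential_integrable: "integrable M (\<lambda>\<omega>. z 0 \<omega> * potential (X j \<omega>))"
  by (rule integrable_mult_of_squares) (auto simp: z_square potential_X_square)

text \<open>Conditioning on \<open>X 0\<close>: the conditional expectation of \<open>z 0\<close> is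
  \<open>potential (X 0 \<omega>)\<close>.\<close>

lemma expectation_z0_potential_0:
  "expectation (\<lambda>\<omega>. z 0 \<omega> * potential (X 0 \<omega>)) = (\<integral>s. (potential s)\<^sup>2 \<partial>law)"
proof -
  let ?g = "\<lambda>p. F (fst p) (snd p) * potential (fst p)"
  have "integrable (law \<Otimes>\<^sub>M law) ?g"
    using z0_potential_integrable[of 0] by (subst integrable_law_pair_iff[OF _ zero_neq_one]) (simp_all add: z_def)
  from law_pair.integral_fst'[OF this]
  have "(\<integral>s. potential s * potential s \<partial>law) = (\<integral>p. ?g p \<partial>(law \<Otimes>\<^sub>M law))"
    by (simp add: potential_def)
  then show ?thesis
    using integral_law_pair_eq[of ?g 0 1] by (simp add: z_def power2_eq_square)
qed

text \<open>Conditioning on \<open>X 0\<close> and \<open>X 1\<close>: these determine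
  \<open>z 0\<close>, and the conditional expectation of \<open>z 1\<close> given them is
  \<open>potential (X 1 \<omega>)\<close>.\<close>

lemma expectation_z0_potential_1:
  "expectation (\<lambda>\<omega>. z 0 \<omega> * potential (X 1 \<omega>)) = expectation (\<lambda>\<omega>. z 0 \<omega> * z 1 \<omega>)"
proof -
  interpret PP: pair_prob_space "law \<Otimes>\<^sub>M law" "law \<Otimes>\<^sub>M law" ..
  let ?g = "\<lambda>q. F (fst (fst q)) (snd (fst q)) * F (snd (fst q)) (fst (snd q))"
  have [measurable]: "?g \<in> borel_measurable ((borel \<Otimes>\<^sub>M borel) \<Otimes>\<^sub>M (borel \<Otimes>\<^sub>M borel))"
    by measurable
  have "integrable ((law \<Otimes>\<^sub>M law) \<Otimes>\<^sub>M (law \<Otimes>\<^sub>M law)) ?g"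
    unfolding distr_quadruple_X[symmetric] using z_mult_integrable[of 0 1]
    by (subst integrable_distr_eq) (simp_all add: z_def numeral_2_eq_2)
  from PP.integral_fst'[OF this]
  have "(\<integral>p. (\<integral>q. F (fst p) (snd p) * F (snd p) (fst q) \<partial>(law \<Otimes>\<^sub>M law)) \<partial>(law \<Otimes>\<^sub>M law))
      = expectation (\<lambda>\<omega>. z 0 \<omega> * z 1 \<omega>)"
    unfolding distr_quadruple_X[symmetric] by (simp add: integral_distr z_def numeral_2_eq_2)
  moreover have "(\<integral>q. F s (fst q) \<partial>(law \<Otimes>\<^sub>M law)) = potential s" for s
    unfolding potential_def
    by (subst integral_law_pair_eq[OF _ zero_neq_one]) (simp_all add: integral_law_eq[of _ 0])
  ultimately have "(\<integral>p. F (fst p) (snd p) * potential (snd p) \<partial>(law \<Otimes>\<^sub>M law)) = expectation (\<lambda>\<omega>. z 0 \<omega> * z 1 \<omega>)"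
    by simp
  then show ?thesis
    by (subst (asm) integral_law_pair_eq[OF _ zero_neq_one]) (simp_all add: z_def)
qed

lemma expectation_potential_mult: "expectation (\<lambda>\<omega>. potential (X 0 \<omega>) * potential (X 1 \<omega>)) = 0"
proof -
  have "indep_var borel (\<lambda>\<omega>. potential (X 0 \<omega>)) borel (\<lambda>\<omega>. potential (X 1 \<omega>))"
    using indep_var_windows[of "{0}" "{1}" "\<lambda>f. potential (f 0)" borel "\<lambda>f. potential (f 1)" borel]
    by simp
  moreover have "integrable M (\<lambda>\<omega>. potential (X j \<omega>))" for j
    by (rule square_integrable_imp_integrable[OF _ potential_X_square]) simp
  ultimately show ?thesis
    using integral_potential integral_law_eq[of potential 0]
    by (subst indep_var_lebesgue_integral) simp_all
qed

text \<open>The function under the square is the martingale difference of the Gordin decomposition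
  of \<^term>\<open>z\<close>.\<close>

lemma asymp_variance_eq:
  "asymp_variance = expectation (\<lambda>\<omega>. (z 0 \<omega> - potential (X 0 \<omega>) + potential (X 1 \<omega>))\<^sup>2)"
proof -
  have "expectation (\<lambda>\<omega>. (z 0 \<omega> - potential (X 0 \<omega>) + potential (X 1 \<omega>))\<^sup>2)
    = expectation (\<lambda>\<omega>. (z 0 \<omega>)\<^sup>2 + (potential (X 0 \<omega>))\<^sup>2 + (potential (X 1 \<omega>))\<^sup>2
        - 2 * (z 0 \<omega> * potential (X 0 \<omega>)) + 2 * (z 0 \<omega> * potential (X 1 \<omega>))
        - 2 * (potential (X 0 \<omega>) * potential (X 1 \<omega>)))"
    by (rule Bochner_Integration.integral_cong) (simp_all add: power2_eq_square algebra_simps)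
  also have "\<dots> = expectation (\<lambda>\<omega>. (z 0 \<omega>)\<^sup>2) + expectation (\<lambda>\<omega>. (potential (X 0 \<omega>))\<^sup>2)
      + expectation (\<lambda>\<omega>. (potential (X 1 \<omega>))\<^sup>2) - 2 * expectation (\<lambda>\<omega>. z 0 \<omega> * potential (X 0 \<omega>))
      + 2 * expectation (\<lambda>\<omega>. z 0 \<omega> * potential (X 1 \<omega>))
      - 2 * expectation (\<lambda>\<omega>. potential (X 0 \<omega>) * potential (X 1 \<omega>))"
    using z_square[of 0] potential_X_square z0_potential_integrable
      integrable_mult_of_squares[of "\<lambda>\<omega>. potential (X 0 \<omega>)" M "\<lambda>\<omega>. potential (X 1 \<omega>)"]
    by simp
  also have "\<dots> = asymp_variance"
    using expectation_z0_potential_0 expectation_z0_potential_1 expectation_potential_mult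
      integral_law_eq[of "\<lambda>s. (potential s)\<^sup>2" 0] integral_law_eq[of "\<lambda>s. (potential s)\<^sup>2" 1]
    by (simp add: asymp_variance_def)
  finally show ?thesis ..
qed

lemma asymp_variance_nonneg: "0 \<le> asymp_variance"
  unfolding asymp_variance_eq by simp

lemma asymp_variance_eq_0_iff:
  "asymp_variance = 0 \<longleftrightarrow> (AE x in law. AE y in law. F x y = potential x - potential y)"
proof -
  have "integrable M (\<lambda>\<omega>. (z 0 \<omega> - potential (X 0 \<omega>) + potential (X 1 \<omega>))\<^sup>2)"
  proof -
    have "(a - b + c)\<^sup>2 = a\<^sup>2 + b\<^sup>2 + c\<^sup>2 - 2 * (a * b) + 2 * (a * c) - 2 * (b * c)" for a b c :: real
      by (simp add: power2_eq_square algebra_simps)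
    then show ?thesis
      using z_square[of 0] potential_X_square z0_potential_integrable
        integrable_mult_of_squares[of "\<lambda>\<omega>. potential (X 0 \<omega>)" M "\<lambda>\<omega>. potential (X 1 \<omega>)"]
      by simp
  qed
  then have "asymp_variance = 0 \<longleftrightarrow> (AE \<omega> in M. z 0 \<omega> - potential (X 0 \<omega>) + potential (X 1 \<omega>) = 0)"
    unfolding asymp_variance_eq by (subst integral_nonneg_eq_0_iff_AE) simp_all
  also have "\<dots> \<longleftrightarrow> (AE \<omega> in M. F (X 0 \<omega>) (X 1 \<omega>) = potential (X 0 \<omega>) - potential (X 1 \<omega>))"
    by (intro AE_cong) (auto simp: z_def)
  also have "\<dots> \<longleftrightarrow> (AE x in law. AE y in law. F x y = potential x - potential y)"
    by (rule AE_pair_law_iff[OF _ zero_neq_one]) measurable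
  finally show ?thesis .
qed

text \<open>A criterion in which \<open>potential\<close> does not occur. Integration over y shows
  that \<open>potential\<close> is c plus the mean of \<open>h\<close> minus \<open>h\<close>; as
  \<open>potential\<close> has mean 0, so c is 0.\<close>

lemma asymp_variance_eq_0_if_coboundary:
  assumes h: "integrable law h" and F_eq: "AE x in law. AE y in law. F x y = c + h y - h x"
  shows "asymp_variance = 0"
proof -
  let ?H = "\<integral>t. h t \<partial>law"
  have pot: "AE x in law. potential x = c + ?H - h x"
    using F_eq
  proof eventually_elim
    case (elim x)
    have "potential x = (\<integral>y. c + h y - h x \<partial>law)"
      unfolding potential_def by (rule integral_cong_AE) (use elim h in auto)
    then show ?case
      using h law.prob_space by simp
  qed
  have "c = 0"
  proof -
    have "0 = (\<integral>x. c + ?H - h x \<partial>law)"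
      using integral_cong_AE[OF _ _ pot] h integral_potential by auto
    then show ?thesis
      using h law.prob_space by simp
  qed
  have "AE x in law. AE y in law. F x y = potential x - potential y"
    using pot F_eq
  proof eventually_elim
    case (elim x)
    show ?case
      using elim(2) pot by eventually_elim (use elim(1) \<open>c = 0\<close> in simp)
  qed
  then show ?thesis
    by (simp add: asymp_variance_eq_0_iff)
qed

end

section \<open>Matrix norms\<close>

lemma
  assumes "is_matrix_norm N"
  shows matrix_norm_nonneg: "0 \<le> N A"
    and matrix_norm_eq_0_iff: "N A = 0 \<longleftrightarrow> A = 0"
    and matrix_norm_scaleR: "N (c *\<^sub>R A) = \<bar>c\<bar> * N A"
    and matrix_norm_triangle: "N (A + B) \<le> N A + N B"
  using assms unfolding is_matrix_norm_def by blast+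

text \<open>A norm is convex, and convex functions on a finite-dimensional space are
  continuous.\<close>

lemma matrix_norm_continuous:
  fixes N :: "real^'n^'n \<Rightarrow> real"
  assumes "is_matrix_norm N"
  shows "continuous_on UNIV N"
proof (rule convex_on_continuous[OF open_UNIV], rule convex_onI)
  fix t :: real and A B :: "real^'n^'n"
  assume t: "0 < t" "t < 1"
  have "N ((1 - t) *\<^sub>R A + t *\<^sub>R B) \<le> N ((1 - t) *\<^sub>R A) + N (t *\<^sub>R B)"
    by (rule matrix_norm_triangle[OF assms])
  also have "N ((1 - t) *\<^sub>R A) = \<bar>1 - t\<bar> * N A"
    by (rule matrix_norm_scaleR[OF assms])
  also have "N (t *\<^sub>R B) = \<bar>t\<bar> * N B"
    by (rule matrix_norm_scaleR[OF assms])
  finally show "N ((1 - t) *\<^sub>R A + t *\<^sub>R B) \<le> (1 - t) * N A + t * N B"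
    using t by simp
qed simp

text \<open>The constant is the minimum of \<open>N\<close> over the unit sphere, attained by
  compactness and positive by definiteness.\<close>

lemma matrix_norm_lower_bound:
  fixes N :: "real^'n^'n \<Rightarrow> real"
  assumes N: "is_matrix_norm N"
  obtains c where "0 < c" "\<And>A. c * norm A \<le> N A"
proof -
  obtain A0 :: "real^'n^'n" where A0: "A0 \<in> sphere 0 1" "\<forall>A\<in>sphere 0 1. N A0 \<le> N A"
    using continuous_attains_inf[OF compact_sphere _ continuous_on_subset[OF matrix_norm_continuous[OF N]],
        of "0 :: real^'n^'n" 1]
    by (auto simp: sphere_eq_empty)
  have "0 < N A0"
    using A0(1) matrix_norm_nonneg[OF N, of A0] matrix_norm_eq_0_iff[OF N, of A0] by auto
  moreover have "N A0 * norm A \<le> N A" for A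
  proof (cases "A = 0")
    case True
    then show ?thesis
      by (simp add: matrix_norm_nonneg[OF N])
  next
    case False
    then have "N A0 \<le> N ((1 / norm A) *\<^sub>R A)"
      by (intro A0(2)[rule_format]) simp
    also have "\<dots> = N A / norm A"
      by (simp add: matrix_norm_scaleR[OF N])
    finally show ?thesis
      using False by (simp add: field_simps)
  qed
  ultimately show thesis
    by (rule that)
qed

section \<open>Rank-one form of the matrix product\<close>

definition outer_mat :: "real \<Rightarrow> real \<Rightarrow> real^2^2" where
  "outer_mat s t = vector [vector [1, s], vector [1 / t, s / t]]"

text \<open>Expansion in the four matrix units, used for the triangle inequality and for
  measurability.\<close>

lemma outer_mat_decomp:
  "outer_mat s t = vector [vector [1, 0], vector [0, 0]] + s *\<^sub>R vector [vector [0, 1], vector [0, 0]]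
    + (1 / t) *\<^sub>R vector [vector [0, 0], vector [1, 0]] + (s / t) *\<^sub>R vector [vector [0, 0], vector [0, 1]]"
  by (simp add: outer_mat_def vec_eq_iff forall_2)

text \<open>The row (1, u) of \<open>Y_mat u\<close> meets the column (1, 1 / t) of
  \<open>outer_mat s t\<close>; their product is the scalar 1 + u / t.\<close>

lemma Y_mat_mult_outer_mat:
  assumes "t \<noteq> 0" "u \<noteq> 0"
  shows "Y_mat u ** outer_mat s t = (1 + u / t) *\<^sub>R outer_mat s u"
  using assms by (simp add: outer_mat_def Y_mat_def matrix_matrix_mult_def vec_eq_iff forall_2 sum_2 field_simps)

lemma S_mat_eq:
  assumes "\<And>j. x (Suc j) \<omega> \<noteq> 0"
  shows "S_mat x (Suc n) \<omega> = (\<Prod>j<n. 1 + x (Suc (Suc j)) \<omega> / x (Suc j) \<omega>) *\<^sub>R outer_mat (x 1 \<omega>) (x (Suc n) \<omega>)"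
proof (induction n)
  case 0
  \<comment> \<open>For nonzero u, \<open>Y_mat u\<close> equals
    \<open>outer_mat u u\<close>.\<close>
  show ?case
    using assms[of 0] by (simp add: outer_mat_def Y_mat_def)
next
  case (Suc n)
  have "S_mat x (Suc (Suc n)) \<omega> = Y_mat (x (Suc (Suc n)) \<omega>) ** S_mat x (Suc n) \<omega>"
    by (rule S_mat.simps)
  also have "\<dots> = (\<Prod>j<n. 1 + x (Suc (Suc j)) \<omega> / x (Suc j) \<omega>) *\<^sub>R
      (Y_mat (x (Suc (Suc n)) \<omega>) ** outer_mat (x 1 \<omega>) (x (Suc n) \<omega>))"
    unfolding Suc.IH by (simp add: matrix_scalar_ac scalar_matrix_assoc flip: scalar_mult_eq_scaleR)
  finally show ?case
    using assms by (simp add: Y_mat_mult_outer_mat)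
qed

text \<open>The corner entry 1 keeps the norm away from 0. From above, the four matrix units give a
  multiple of 1 + |s| + 1/|t| + |s/t| = (1 + |s|) (1 + 1/|t|), whose logarithm splits into two terms
  controlled by the moment hypotheses.\<close>

lemma ln_norm_outer_mat_bound:
  assumes N: "is_matrix_norm N"
  obtains C where "\<And>s t. t \<noteq> 0 \<Longrightarrow> 0 < N (outer_mat s t) \<and>
    \<bar>ln (N (outer_mat s t))\<bar> \<le> C + ln (1 + \<bar>s\<bar>) + ln (1 + 1 / \<bar>t\<bar>)"
proof -
  obtain c where c: "0 < c" "\<And>A. c * norm A \<le> N A"
    using matrix_norm_lower_bound[OF N] by blast
  let ?E1 = "vector [vector [1, 0], vector [0, 0]] :: real^2^2"
  let ?E2 = "vector [vector [0, 1], vector [0, 0]] :: real^2^2"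
  let ?E3 = "vector [vector [0, 0], vector [1, 0]] :: real^2^2"
  let ?E4 = "vector [vector [0, 0], vector [0, 1]] :: real^2^2"
  \<comment> \<open>The summand 1 makes \<open>ln D\<close> nonnegative.\<close>
  define D where "D = 1 + N ?E1 + N ?E2 + N ?E3 + N ?E4"
  note N_nonneg = matrix_norm_nonneg[OF N] and N_add = matrix_norm_triangle[OF N] and N_scale = matrix_norm_scaleR[OF N]
  have D: "1 \<le> D" "N ?E1 \<le> D" "N ?E2 \<le> D" "N ?E3 \<le> D" "N ?E4 \<le> D"
    using N_nonneg[of ?E1] N_nonneg[of ?E2] N_nonneg[of ?E3] N_nonneg[of ?E4] unfolding D_def by linarith+
  have "0 < N (outer_mat s t) \<and>
      \<bar>ln (N (outer_mat s t))\<bar> \<le> (\<bar>ln c\<bar> + ln D) + ln (1 + \<bar>s\<bar>) + ln (1 + 1 / \<bar>t\<bar>)" if "t \<noteq> 0" for s t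
  proof -
    have "1 \<le> \<bar>outer_mat s t $ 1 $ 1\<bar>"
      by (simp add: outer_mat_def)
    also have "\<dots> \<le> norm (outer_mat s t)"
      using component_le_norm_cart[of "outer_mat s t $ 1" 1] Finite_Cartesian_Product.norm_nth_le[of "outer_mat s t" 1] by linarith
    finally have "c * 1 \<le> c * norm (outer_mat s t)"
      using c(1) by (intro mult_left_mono) auto
    then have lower: "c \<le> N (outer_mat s t)"
      using c(2)[of "outer_mat s t"] by linarith
    have "N (outer_mat s t) \<le> N ?E1 + \<bar>s\<bar> * N ?E2 + \<bar>1 / t\<bar> * N ?E3 + \<bar>s / t\<bar> * N ?E4"
      unfolding outer_mat_decomp N_scale[symmetric]
      by (intro order.trans[OF N_add] add_mono order.refl)
    also have "\<dots> \<le> D + \<bar>s\<bar> * D + \<bar>1 / t\<bar> * D + \<bar>s / t\<bar> * D"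
      using D by (intro add_mono mult_left_mono) auto
    also have "\<dots> = D * ((1 + \<bar>s\<bar>) * (1 + 1 / \<bar>t\<bar>))"
      by (simp add: algebra_simps add_divide_distrib)
    finally have "ln (N (outer_mat s t)) \<le> ln (D * ((1 + \<bar>s\<bar>) * (1 + 1 / \<bar>t\<bar>)))"
      using lower c(1) by (intro ln_mono) auto
    also have "\<dots> = ln D + ln (1 + \<bar>s\<bar>) + ln (1 + 1 / \<bar>t\<bar>)"
    proof -
      have "0 < 1 + \<bar>s\<bar>" "0 < 1 + 1 / \<bar>t\<bar>"
        by (simp_all add: add_pos_nonneg)
      then show ?thesis
        using D(1) by (simp add: ln_mult)
    qed
    finally have upper: "ln (N (outer_mat s t)) \<le> ln D + ln (1 + \<bar>s\<bar>) + ln (1 + 1 / \<bar>t\<bar>)" .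
    have "ln c \<le> ln (N (outer_mat s t))"
      using lower c(1) by (intro ln_mono) auto
    moreover have "0 \<le> ln D" "0 \<le> ln (1 + \<bar>s\<bar>)" "0 \<le> ln (1 + 1 / \<bar>t\<bar>)"
      using D(1) by auto
    ultimately show ?thesis
      using upper lower c(1) by linarith
  qed
  then show thesis
    by (rule that)
qed

section \<open>The quadratic relation between atoms\<close>

text \<open>The equation forces \<^term>\<open>K = 4\<close> at the diagonal point (a, a) of an atom a, and then the
  quotient of two distinct atoms is a root of \<open>r\<^sup>2 + 6 * r + 1\<close>; in particular two distinct atoms have
  opposite signs, so there are at most two of them.\<close>

lemma atoms_of_quadratic_relation:
  fixes M :: "real measure"
  assumes "prob_space M" and sets_M: "sets M = sets borel"
    and nonzero: "AE x in M. x \<noteq> 0"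
    and rel: "AE x in M. AE y in M. (x + y)\<^sup>2 = K * \<bar>x * y\<bar>"
  shows "\<exists>a. a \<noteq> 0 \<and> (measure M {a} = 1 \<or>
    (\<exists>r\<in>{-3 - 2 * sqrt 2, -3 + 2 * sqrt 2}. 0 < measure M {a} \<and> measure M {a} < 1 \<and> measure M {a} + measure M {r * a} = 1))"
proof -
  interpret prob_space M by fact
  have space_M: "space M = UNIV"
    using sets_eq_imp_space_eq[OF sets_M] by simp
  have singleton: "{x} \<in> events" for x
    by (simp add: sets_M)
  define S where "S = {x. 0 < prob {x}}"
  \<comment> \<open>A property that holds almost everywhere holds at every atom.\<close>
  have atom: "Q a" if "a \<in> S" and ae: "AE x in M. Q x" for Q a
  proof (rule ccontr)
    assume "\<not> Q a"
    have "AE x in M. x \<notin> {a}"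
      using ae by eventually_elim (use \<open>\<not> Q a\<close> in auto)
    then show False
      using prob_eq_0[OF singleton, of a] that(1) by (simp add: S_def)
  qed
  \<comment> \<open>Almost every point qualifies as \<open>x0\<close>, so one exists. Fixing it
    confines the whole mass to its solution set \<open>R\<close>.\<close>
  have "\<exists>x0. x0 \<noteq> 0 \<and> (AE y in M. (x0 + y)\<^sup>2 = K * \<bar>x0 * y\<bar>)"
  proof (rule ccontr)
    assume none: "\<not> ?thesis"
    have "AE x in M. False"
      using eventually_conj[OF nonzero rel] by (rule eventually_mono) (use none in blast)
    then show False
      by simp
  qed
  then obtain x0 where x0: "x0 \<noteq> 0" "AE y in M. (x0 + y)\<^sup>2 = K * \<bar>x0 * y\<bar>"
    by blast
  define R where "R = {y. (x0 + y)\<^sup>2 = K * \<bar>x0 * y\<bar>}"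
  have "finite R"
  proof (rule finite_subset)
    \<comment> \<open>\<open>poly (?p k) y\<close> is (x0 + y)^2 - k * y; the sign of y decides
      between the two values of k.\<close>
    let ?p = "\<lambda>k. [:x0\<^sup>2, 2 * x0 - k, 1:]"
    show "R \<subseteq> {y. poly (?p (K * \<bar>x0\<bar>)) y = 0} \<union> {y. poly (?p (- K * \<bar>x0\<bar>)) y = 0}"
      by (auto simp: R_def power2_eq_square algebra_simps abs_mult abs_if split: if_splits)
    show "finite ({y. poly (?p (K * \<bar>x0\<bar>)) y = 0} \<union> {y. poly (?p (- K * \<bar>x0\<bar>)) y = 0})"
      by (intro finite_UnI poly_roots_finite) auto
  qed
  have R_events: "R \<in> events"
    using \<open>finite R\<close> by (simp add: sets_M finite_imp_closed)
  have S_R: "S \<subseteq> R"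
    using atom[OF _ x0(2)] by (auto simp: R_def)
  then have "finite S"
    using \<open>finite R\<close> finite_subset by blast
  \<comment> \<open>The finite set \<open>R\<close> has probability 1, and its points outside
    \<open>S\<close> carry no mass, so the law is purely atomic.\<close>
  have "(\<Sum>x\<in>S. prob {x}) = (\<Sum>x\<in>R. prob {x})"
    using S_R \<open>finite R\<close> by (intro sum.mono_neutral_left) (auto simp: S_def zero_less_measure_iff)
  also have "\<dots> = prob R"
    using \<open>finite R\<close> singleton by (intro finite_measure_eq_sum_singleton[symmetric]) auto
  also have "\<dots> = 1"
    using x0(2) prob_eq_1[OF R_events] by (simp add: R_def)
  finally have sum_S: "(\<Sum>x\<in>S. prob {x}) = 1" .
  have rel_S: "(a + b)\<^sup>2 = K * \<bar>a * b\<bar>" if "a \<in> S" "b \<in> S" for a b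
    using atom[OF that(2) atom[OF that(1) rel]] .
  have nonzero_S: "a \<noteq> 0" if "a \<in> S" for a
    using atom[OF that nonzero] .
  obtain a where a: "a \<in> S"
    using sum_S by fastforce
  have "a\<^sup>2 * K = a\<^sup>2 * 4"
    using rel_S[OF a a] by (simp add: power2_eq_square)
  then have "K = 4"
    using nonzero_S[OF a] by simp
  have opposite: "b * c < 0" if "b \<in> S" "c \<in> S" "b \<noteq> c" for b c
  proof (rule ccontr)
    assume "\<not> b * c < 0"
    then have "(b - c)\<^sup>2 = 0"
      using rel_S[OF that(1,2)] \<open>K = 4\<close> by (simp add: power2_eq_square algebra_simps)
    then show False
      using that(3) by simp
  qed
  show ?thesis
  proof (cases "S = {a}")
    case True
    then show ?thesis
      using sum_S nonzero_S[OF a] by auto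
  next
    case False
    then obtain b where b: "b \<in> S" "b \<noteq> a"
      using a by blast
    have "c = a \<or> c = b" if "c \<in> S" for c
    proof (rule ccontr)
      assume "\<not> ?thesis"
      then have "a * b < 0" "a * c < 0" "b * c < 0"
        using opposite a b that by blast+
      then show False
        by (auto simp: mult_less_0_iff)
    qed
    then have S: "S = {a, b}"
      using a b by blast
    have "a * b < 0"
      using opposite[OF a b(1)] b(2) by blast
    \<comment> \<open>With opposite signs the relation becomes b^2 + 6 a b + a^2 = 0, and the square
      is completed.\<close>
    then have "(b + 3 * a)\<^sup>2 = (2 * sqrt 2 * a)\<^sup>2"
      using rel_S[OF a b(1)] \<open>K = 4\<close> by (simp add: power2_eq_square algebra_simps)
    then have "b = (-3 - 2 * sqrt 2) * a \<or> b = (-3 + 2 * sqrt 2) * a"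
      unfolding power2_eq_iff by (auto simp: algebra_simps)
    moreover have "prob {a} + prob {b} = 1"
      using sum_S b(2) unfolding S by simp
    moreover have "0 < prob {a}" "0 < prob {b}"
      using a b by (simp_all add: S_def)
    ultimately show ?thesis
      using nonzero_S[OF a] by (intro exI[of _ a]) auto
  qed
qed

text \<open>Equal points satisfy the relation trivially. For the pair (a, r a) with r < 0 it amounts
  to r^2 + 6 r + 1 = 0, which both values of \<open>r\<close> satisfy.\<close>

lemma quadratic_relation_of_atoms:
  fixes M :: "real measure"
  assumes "prob_space M" and sets_M: "sets M = sets borel"
    and a: "a \<noteq> 0"
    and atoms: "measure M {a} = 1 \<or> r \<in> {-3 - 2 * sqrt 2, -3 + 2 * sqrt 2} \<and> measure M {a} + measure M {r * a} = 1"
  shows "AE x in M. AE y in M. (x + y)\<^sup>2 = 4 * \<bar>x * y\<bar>"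
proof -
  interpret prob_space M by fact
  show ?thesis
    using atoms
  proof
    assume "prob {a} = 1"
    then have ae: "AE x in M. x \<in> {a}"
      by (rule AE_prob_1)
    show ?thesis
      using ae
    proof eventually_elim
      case (elim x)
      show ?case
        using ae by eventually_elim (use elim in \<open>simp add: power2_eq_square\<close>)
    qed
  next
    assume r: "r \<in> {-3 - 2 * sqrt 2, -3 + 2 * sqrt 2} \<and> prob {a} + prob {r * a} = 1"
    \<comment> \<open>This makes -3 + 2 * sqrt 2 negative.\<close>
    have "sqrt 2 < 3 / 2"
      by (rule real_less_lsqrt) (simp_all add: power2_eq_square)
    moreover have "0 < sqrt 2"
      by simp
    ultimately have "r < 0"
      using r by (elim conjE insertE emptyE) linarith+
    have "(r + 3)\<^sup>2 = (2 * sqrt 2)\<^sup>2"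
      using r unfolding power2_eq_iff by auto
    then have "r * r + 6 * r + 1 = 0"
      by (simp add: power2_eq_square algebra_simps)
    have "a \<noteq> r * a"
      using \<open>r < 0\<close> a by simp
    then have "prob {a, r * a} = 1"
      using r finite_measure_eq_sum_singleton[of "{a, r * a}"] by (simp add: sets_M)
    then have ae: "AE x in M. x \<in> {a, r * a}"
      by (rule AE_prob_1)
    have mixed: "(a + r * a)\<^sup>2 = 4 * \<bar>a * (r * a)\<bar>"
    proof -
      have "(a + r * a)\<^sup>2 = (r * r + 6 * r + 1) * (a * a) - 4 * r * (a * a)"
        by (simp add: power2_eq_square algebra_simps)
      also have "\<dots> = 4 * (- r * (a * a))"
        unfolding \<open>r * r + 6 * r + 1 = 0\<close> by simp
      also have "- r * (a * a) = \<bar>a * (r * a)\<bar>"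
        using \<open>r < 0\<close> by (simp add: abs_mult)
      finally show ?thesis .
    qed
    have same: "(b + b)\<^sup>2 = 4 * \<bar>b * b\<bar>" for b :: real
      by (simp add: power2_eq_square)
    have all: "(x + y)\<^sup>2 = 4 * \<bar>x * y\<bar>" if "x \<in> {a, r * a}" "y \<in> {a, r * a}" for x y
      using that mixed same[of a] same[of "r * a"] by (auto simp: add.commute mult.commute)
    show ?thesis
      using ae
    proof eventually_elim
      case (elim x)
      show ?case
        using ae by eventually_elim (rule all[OF elim])
    qed
  qed
qed

section \<open>Products of the random matrices\<close>

text \<open>The convention log 0 = -infinity enters the proof here: finiteness forces
  \<open>g\<close> to be nonzero almost everywhere, and there \<open>elog\<close> and
  \<open>ln\<close> agree.\<close>

lemma finite_elog_square:
  fixes g :: "'a \<Rightarrow> real"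
  assumes [measurable]: "g \<in> borel_measurable M"
    and finite: "(\<integral>\<^sup>+\<omega>. e2ennreal ((elog \<bar>g \<omega>\<bar>)\<^sup>2) \<partial>M) < \<infinity>"
  shows "AE \<omega> in M. g \<omega> \<noteq> 0" "integrable M (\<lambda>\<omega>. (ln \<bar>g \<omega>\<bar>)\<^sup>2)"
proof -
  let ?h = "\<lambda>\<omega>. if g \<omega> = 0 then \<infinity> else ennreal ((ln \<bar>g \<omega>\<bar>)\<^sup>2)"
  have fin: "(\<integral>\<^sup>+\<omega>. ?h \<omega> \<partial>M) < \<infinity>"
    using finite unfolding elog_abs_sq .
  then have "AE \<omega> in M. ?h \<omega> \<noteq> \<infinity>"
    by (intro nn_integral_PInf_AE) auto
  then show "AE \<omega> in M. g \<omega> \<noteq> 0"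
    by eventually_elim auto
  have "(\<integral>\<^sup>+\<omega>. ennreal ((ln \<bar>g \<omega>\<bar>)\<^sup>2) \<partial>M) \<le> (\<integral>\<^sup>+\<omega>. ?h \<omega> \<partial>M)"
    by (intro nn_integral_mono) auto
  then show "integrable M (\<lambda>\<omega>. (ln \<bar>g \<omega>\<bar>)\<^sup>2)"
    using fin by (intro integrableI_nonneg) (auto simp: order.strict_trans1)
qed

lemma ln_abs_one_plus_ratio:
  fixes s t :: real
  assumes "s \<noteq> 0" "s + t \<noteq> 0"
  shows "ln \<bar>1 + t / s\<bar> = ln \<bar>s + t\<bar> - ln \<bar>s\<bar>"
proof -
  have "1 + t / s = (s + t) / s"
    using assms by (simp add: field_simps)
  then show ?thesis
    using assms by (simp add: abs_divide ln_div)
qed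

text \<open>The inherited sequence is indexed from 0, so its j-th member is
  \<open>x (Suc j)\<close>, and the first ratio, of \<open>x 2\<close> to \<open>x 1\<close>,
  belongs to \<open>z 0\<close>.\<close>

locale random_matrix_product = iid_sequence M "\<lambda>j. x (Suc j)"
  for M :: "'a measure" and x :: "nat \<Rightarrow> 'a \<Rightarrow> real" +
  fixes N :: "real^2^2 \<Rightarrow> real"
  assumes nonzero: "\<omega> \<in> space M \<Longrightarrow> x (Suc j) \<omega> \<noteq> 0"
    and ln_integrable: "integrable M (\<lambda>\<omega>. ln (1 + \<bar>x 1 \<omega>\<bar>))"
      "integrable M (\<lambda>\<omega>. ln (1 + 1 / \<bar>x 1 \<omega>\<bar>))"
    and ratio_neq: "AE \<omega> in M. 1 + x 2 \<omega> / x 1 \<omega> \<noteq> 0"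
    and ratio_square: "integrable M (\<lambda>\<omega>. (ln \<bar>1 + x 2 \<omega> / x 1 \<omega>\<bar>)\<^sup>2)"
    and matrix_norm: "is_matrix_norm N"
begin

definition lam :: real where
  "lam = expectation (\<lambda>\<omega>. ln \<bar>1 + x 2 \<omega> / x 1 \<omega>\<bar>)"

lemma x_measurable [measurable]: "x (Suc j) \<in> borel_measurable M"
  by (rule X_measurable)

lemma x_measurable_numeral [measurable]:
  "x 1 \<in> borel_measurable M" "x 2 \<in> borel_measurable M" "x 3 \<in> borel_measurable M"
  using x_measurable[of 0] x_measurable[of 1] x_measurable[of 2] by (simp_all add: numeral_2_eq_2 numeral_3_eq_3)

lemma ratio_integrable: "integrable M (\<lambda>\<omega>. ln \<bar>1 + x 2 \<omega> / x 1 \<omega>\<bar>)"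
  by (rule square_integrable_imp_integrable[OF _ ratio_square]) measurable

sublocale centered_pair_functional M "\<lambda>j. x (Suc j)" "\<lambda>s t. ln \<bar>1 + t / s\<bar> - lam"
proof
  show "(\<lambda>(s, t). ln \<bar>1 + t / s\<bar> - lam) \<in> borel_measurable (borel \<Otimes>\<^sub>M borel)"
    by measurable
  show "integrable M (\<lambda>\<omega>. (ln \<bar>1 + x (Suc 1) \<omega> / x (Suc 0) \<omega>\<bar> - lam)\<^sup>2)"
    using ratio_square ratio_integrable by (simp add: power2_diff flip: numeral_2_eq_2)
  show "expectation (\<lambda>\<omega>. ln \<bar>1 + x (Suc 1) \<omega> / x (Suc 0) \<omega>\<bar> - lam) = 0"
    using ratio_integrable prob_space by (simp add: lam_def flip: numeral_2_eq_2)
qed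

lemma z_eq: "z j \<omega> = ln \<bar>1 + x (Suc (Suc j)) \<omega> / x (Suc j) \<omega>\<bar> - lam"
  by (simp add: z_def)

lemma x_nonzero_AE: "AE s in law. s \<noteq> 0"
  unfolding law_def by (subst AE_distr_iff) (auto intro!: AE_I2 nonzero)

lemma ratio_neq_law: "AE s in law. AE t in law. 1 + t / s \<noteq> 0"
  using ratio_neq
  by (subst AE_pair_law_iff[OF _ zero_neq_one, symmetric]) (simp_all flip: numeral_2_eq_2)

lemma ratio_neq_all: "AE \<omega> in M. \<forall>j. 1 + x (Suc (Suc j)) \<omega> / x (Suc j) \<omega> \<noteq> 0"
  unfolding AE_all_countable
proof
  fix j
  have "Measurable.pred (borel \<Otimes>\<^sub>M borel) (\<lambda>p :: real \<times> real. 1 + snd p / fst p \<noteq> 0)"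
    by measurable
  from AE_pair_law_iff[OF this, of j "Suc j"] ratio_neq_law
  show "AE \<omega> in M. 1 + x (Suc (Suc j)) \<omega> / x (Suc j) \<omega> \<noteq> 0"
    by simp
qed

lemma norm_S_mat_eq:
  assumes "\<omega> \<in> space M"
  shows "N (S_mat x (Suc n) \<omega>) =
    (\<Prod>j<n. \<bar>1 + x (Suc (Suc j)) \<omega> / x (Suc j) \<omega>\<bar>) * N (outer_mat (x 1 \<omega>) (x (Suc n) \<omega>))"
  using S_mat_eq[of x \<omega> n] nonzero[OF assms] by (simp add: matrix_norm_scaleR[OF matrix_norm] abs_prod)

lemma norm_outer_mat_measurable [measurable]:
  "(\<lambda>\<omega>. N (outer_mat (x 1 \<omega>) (x (Suc n) \<omega>))) \<in> borel_measurable M"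
proof -
  have "N \<in> borel_measurable borel"
    by (rule borel_measurable_continuous_onI[OF matrix_norm_continuous[OF matrix_norm]])
  moreover have "(\<lambda>\<omega>. outer_mat (x 1 \<omega>) (x (Suc n) \<omega>)) \<in> borel_measurable M"
    unfolding outer_mat_decomp by measurable
  ultimately show ?thesis
    by (rule measurable_compose[rotated])
qed

lemma ln_norm_S_mat_measurable [measurable]: "(\<lambda>\<omega>. ln (N (S_mat x n \<omega>))) \<in> borel_measurable M"
proof (cases n)
  case (Suc m)
  have "(\<lambda>\<omega>. ln (N (S_mat x n \<omega>))) \<in> borel_measurable M \<longleftrightarrow>
    (\<lambda>\<omega>. ln ((\<Prod>j<m. \<bar>1 + x (Suc (Suc j)) \<omega> / x (Suc j) \<omega>\<bar>) * N (outer_mat (x 1 \<omega>) (x (Suc m) \<omega>)))) \<in> borel_measurable M"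
    unfolding Suc by (rule measurable_cong) (simp only: norm_S_mat_eq)
  moreover have "\<dots>"
    by measurable
  ultimately show ?thesis
    by blast
qed simp

text \<open>The logarithm of the product splits off the null set where some ratio factor
  vanishes.\<close>

lemma ln_norm_S_mat_eq:
  "AE \<omega> in M. ln (N (S_mat x (Suc n) \<omega>)) =
    (\<Sum>j<n. ln \<bar>1 + x (Suc (Suc j)) \<omega> / x (Suc j) \<omega>\<bar>) + ln (N (outer_mat (x 1 \<omega>) (x (Suc n) \<omega>)))"
  using ratio_neq_all AE_space[of M]
proof eventually_elim
  case (elim \<omega>)
  obtain C where "\<And>s t. t \<noteq> 0 \<Longrightarrow> 0 < N (outer_mat s t) \<and>
      \<bar>ln (N (outer_mat s t))\<bar> \<le> C + ln (1 + \<bar>s\<bar>) + ln (1 + 1 / \<bar>t\<bar>)"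
    using ln_norm_outer_mat_bound[OF matrix_norm] by blast
  then have "0 < N (outer_mat (x 1 \<omega>) (x (Suc n) \<omega>))"
    using nonzero[OF elim(2)] by blast
  moreover have "0 < (\<Prod>j<n. \<bar>1 + x (Suc (Suc j)) \<omega> / x (Suc j) \<omega>\<bar>)"
    using elim(1) by (intro prod_pos) simp
  moreover have "ln (\<Prod>j<n. \<bar>1 + x (Suc (Suc j)) \<omega> / x (Suc j) \<omega>\<bar>) = (\<Sum>j<n. ln \<bar>1 + x (Suc (Suc j)) \<omega> / x (Suc j) \<omega>\<bar>)"
    using elim(1) by (intro ln_prod) simp_all
  ultimately show ?case
    unfolding norm_S_mat_eq[OF elim(2)] by (simp only: ln_mult_pos)
qed

text \<open>For n >= 1 the difference involves the log-norm of one \<open>outer_mat\<close>, one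
  term of \<open>z\<close> and a constant. By identical distribution the dominating function
  \<open>?r n\<close> has the same expectation for all n.\<close>

lemma ln_norm_S_mat_L1_close:
  obtains B where "\<And>n. integrable M (\<lambda>\<omega>. ln (N (S_mat x n \<omega>)) - real n * lam - (\<Sum>i<n. z i \<omega>))"
    "\<And>n. expectation (\<lambda>\<omega>. \<bar>ln (N (S_mat x n \<omega>)) - real n * lam - (\<Sum>i<n. z i \<omega>)\<bar>) \<le> B"
proof -
  obtain C where C: "\<And>s t. t \<noteq> 0 \<Longrightarrow> 0 < N (outer_mat s t) \<and>
      \<bar>ln (N (outer_mat s t))\<bar> \<le> C + ln (1 + \<bar>s\<bar>) + ln (1 + 1 / \<bar>t\<bar>)"
    using ln_norm_outer_mat_bound[OF matrix_norm] by blast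
  let ?d = "\<lambda>n \<omega>. ln (N (S_mat x n \<omega>)) - real n * lam - (\<Sum>i<n. z i \<omega>)"
  let ?r = "\<lambda>n \<omega>. C + ln (1 + \<bar>x 1 \<omega>\<bar>) + ln (1 + 1 / \<bar>x (Suc n) \<omega>\<bar>) + \<bar>z n \<omega>\<bar> + \<bar>lam\<bar>"
  have ln_int: "integrable M (\<lambda>\<omega>. ln (1 + 1 / \<bar>x (Suc n) \<omega>\<bar>))" for n
    using ln_integrable(2) integrable_law_iff[of "\<lambda>t. ln (1 + 1 / \<bar>t\<bar>)" n] integrable_law_iff[of "\<lambda>t. ln (1 + 1 / \<bar>t\<bar>)" 0]
    by simp
  have r_int: "integrable M (?r n)" for n
    using ln_int ln_integrable(1) z_integrable by simp
  have d_le: "AE \<omega> in M. \<bar>?d (Suc n) \<omega>\<bar> \<le> ?r n \<omega>" for n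
    using ln_norm_S_mat_eq[of n] AE_space[of M]
  proof eventually_elim
    case (elim \<omega>)
    \<comment> \<open>A product of n + 1 matrices has only n ratio factors; the surplus
      \<open>z n\<close> and one \<open>lam\<close> pass into the error.\<close>
    have "?d (Suc n) \<omega> = ln (N (outer_mat (x 1 \<omega>) (x (Suc n) \<omega>))) - z n \<omega> - lam"
      unfolding elim(1) by (simp add: z_eq sum_subtractf algebra_simps)
    then show ?case
      using C[of "x (Suc n) \<omega>" "x 1 \<omega>"] nonzero[OF elim(2)] by auto
  qed
  have d_int_Suc: "integrable M (?d (Suc n))" for n
  proof (rule Bochner_Integration.integrable_bound[OF r_int[of n]])
    show "?d (Suc n) \<in> borel_measurable M"
      by measurable
    show "AE \<omega> in M. norm (?d (Suc n) \<omega>) \<le> norm (?r n \<omega>)"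
      using d_le[of n] by eventually_elim (simp only: real_norm_def order.trans[OF _ abs_ge_self])
  qed
  have d_int: "integrable M (?d n)" for n
    using d_int_Suc by (cases n) simp_all
  have r_const: "expectation (?r n) = expectation (?r 0)" for n
  proof -
    have "expectation (\<lambda>\<omega>. ln (1 + 1 / \<bar>x (Suc n) \<omega>\<bar>)) = expectation (\<lambda>\<omega>. ln (1 + 1 / \<bar>x (Suc 0) \<omega>\<bar>))"
      using integral_law_eq[of "\<lambda>t. ln (1 + 1 / \<bar>t\<bar>)" n] integral_law_eq[of "\<lambda>t. ln (1 + 1 / \<bar>t\<bar>)" 0]
      by simp
    moreover have "expectation (\<lambda>\<omega>. \<bar>z n \<omega>\<bar>) = expectation (\<lambda>\<omega>. \<bar>z 0 \<omega>\<bar>)"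
      using arg_cong[OF distr_z[of n], of "\<lambda>\<mu>. \<integral>x. \<bar>x\<bar> \<partial>\<mu>"] by (simp add: integral_distr)
    ultimately show ?thesis
      using ln_int ln_integrable(1) z_integrable by simp
  qed
  \<comment> \<open>\<open>S_mat x 0\<close> is the identity, outside the rank-one form, so n = 0
    contributes its own bound.\<close>
  have "expectation (\<lambda>\<omega>. \<bar>?d n \<omega>\<bar>) \<le> max (expectation (\<lambda>\<omega>. \<bar>?d 0 \<omega>\<bar>)) (expectation (?r 0))" for n
  proof (cases n)
    case (Suc m)
    have "expectation (\<lambda>\<omega>. \<bar>?d (Suc m) \<omega>\<bar>) \<le> expectation (?r m)"
      using d_int r_int d_le by (intro integral_mono_AE integrable_abs)
    then show ?thesis
      unfolding Suc r_const[of m] by (rule max.coboundedI2)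
  qed simp
  then show thesis
    using d_int by (rule that[rotated])
qed

lemma ln_norm_S_mat_integrable: "integrable M (\<lambda>\<omega>. ln (N (S_mat x n \<omega>)))"
proof -
  obtain B where "\<And>n. integrable M (\<lambda>\<omega>. ln (N (S_mat x n \<omega>)) - real n * lam - (\<Sum>i<n. z i \<omega>))"
    using ln_norm_S_mat_L1_close by blast
  then have "integrable M (\<lambda>\<omega>. (ln (N (S_mat x n \<omega>)) - real n * lam - (\<Sum>i<n. z i \<omega>)) + (real n * lam + (\<Sum>i<n. z i \<omega>)))"
    using z_integrable by (intro Bochner_Integration.integrable_add) simp_all
  then show ?thesis
    by simp
qed

text \<open>The sums of \<open>z\<close> have mean 0, so the expected log-norm differs from n * lam
  by at most a constant.\<close>

lemma mean_log_growth_tendsto: "mean_log_growth M N x \<longlonglongrightarrow> lam"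
proof -
  obtain B where int: "\<And>n. integrable M (\<lambda>\<omega>. ln (N (S_mat x n \<omega>)) - real n * lam - (\<Sum>i<n. z i \<omega>))"
    and B: "\<And>n. expectation (\<lambda>\<omega>. \<bar>ln (N (S_mat x n \<omega>)) - real n * lam - (\<Sum>i<n. z i \<omega>)\<bar>) \<le> B"
    using ln_norm_S_mat_L1_close by blast
  have "norm (mean_log_growth M N x n - lam) \<le> B * inverse (real n)" if "0 < n" for n
  proof -
    have "expectation (\<lambda>\<omega>. ln (N (S_mat x n \<omega>)) - real n * lam - (\<Sum>i<n. z i \<omega>))
        = expectation (\<lambda>\<omega>. ln (N (S_mat x n \<omega>))) - real n * lam"
      using ln_norm_S_mat_integrable z_integrable prob_space by (simp add: expectation_z)
    then have "\<bar>expectation (\<lambda>\<omega>. ln (N (S_mat x n \<omega>))) - real n * lam\<bar> \<le> B"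
      using integral_abs_bound[of M "\<lambda>\<omega>. ln (N (S_mat x n \<omega>)) - real n * lam - (\<Sum>i<n. z i \<omega>)"] B[of n]
      by simp
    then have "\<bar>expectation (\<lambda>\<omega>. ln (N (S_mat x n \<omega>))) - real n * lam\<bar> / real n \<le> B / real n"
      by (rule divide_right_mono) simp
    moreover have "mean_log_growth M N x n - lam = (expectation (\<lambda>\<omega>. ln (N (S_mat x n \<omega>))) - real n * lam) / real n"
      using that by (simp add: mean_log_growth_def diff_divide_distrib)
    ultimately show ?thesis
      by (simp add: abs_mult divide_inverse)
  qed
  then have "eventually (\<lambda>n. norm (mean_log_growth M N x n - lam) \<le> B * inverse (real n)) sequentially"
    by (intro eventually_sequentiallyI[of 1]) simp
  then have "(\<lambda>n. mean_log_growth M N x n - lam) \<longlonglongrightarrow> 0"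
    by (rule Lim_null_comparison) (rule tendsto_mult_right_zero[OF lim_inverse_n])
  then show ?thesis
    by (simp add: LIM_zero_iff)
qed

lemma lyapunov_exponent_eq: "lyapunov_exponent M N x = lam"
  unfolding lyapunov_exponent_def by (rule limI[OF mean_log_growth_tendsto])

lemma ratio_mult:
  "integrable M (\<lambda>\<omega>. ln \<bar>1 + x 2 \<omega> / x 1 \<omega>\<bar> * ln \<bar>1 + x 3 \<omega> / x 2 \<omega>\<bar>)"
  "expectation (\<lambda>\<omega>. ln \<bar>1 + x 2 \<omega> / x 1 \<omega>\<bar> * ln \<bar>1 + x 3 \<omega> / x 2 \<omega>\<bar>)
    = expectation (\<lambda>\<omega>. z 0 \<omega> * z 1 \<omega>) + lam\<^sup>2"
proof -
  have "ln \<bar>1 + x 2 \<omega> / x 1 \<omega>\<bar> * ln \<bar>1 + x 3 \<omega> / x 2 \<omega>\<bar>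
      = z 0 \<omega> * z 1 \<omega> + lam * z 0 \<omega> + lam * z 1 \<omega> + lam\<^sup>2" for \<omega>
    by (simp add: z_eq power2_eq_square algebra_simps flip: numeral_2_eq_2)
  then show
    "integrable M (\<lambda>\<omega>. ln \<bar>1 + x 2 \<omega> / x 1 \<omega>\<bar> * ln \<bar>1 + x 3 \<omega> / x 2 \<omega>\<bar>)"
    "expectation (\<lambda>\<omega>. ln \<bar>1 + x 2 \<omega> / x 1 \<omega>\<bar> * ln \<bar>1 + x 3 \<omega> / x 2 \<omega>\<bar>)
      = expectation (\<lambda>\<omega>. z 0 \<omega> * z 1 \<omega>) + lam\<^sup>2"
    using z_integrable z_mult_integrable prob_space by (simp_all add: expectation_z)
qed

text \<open>Centring subtracts lam^2 once from the second moment and twice through the doubled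
  covariance, which accounts for the coefficient 3.\<close>

lemma asymp_var_eq: "asymp_var M N x = asymp_variance"
proof -
  have "expectation (\<lambda>\<omega>. (z 0 \<omega>)\<^sup>2) = expectation (\<lambda>\<omega>. (ln \<bar>1 + x 2 \<omega> / x 1 \<omega>\<bar>)\<^sup>2) - lam\<^sup>2"
    using variance_eq[OF ratio_integrable ratio_square, folded lam_def] by (simp add: z_eq flip: numeral_2_eq_2)
  then show ?thesis
    unfolding asymp_var_def asymp_variance_def lyapunov_exponent_eq ratio_mult(2) by simp
qed

lemma clt_ln_norm_S_mat:
  "weak_conv_m (\<lambda>n. distr M borel (\<lambda>\<omega>. (ln (N (S_mat x n \<omega>)) - real n * lam) / sqrt (real n)))
    (centered_gaussian asymp_variance)"
proof -
  obtain B where "\<And>n. integrable M (\<lambda>\<omega>. ln (N (S_mat x n \<omega>)) - real n * lam - (\<Sum>i<n. z i \<omega>))"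
    and "\<And>n. expectation (\<lambda>\<omega>. \<bar>ln (N (S_mat x n \<omega>)) - real n * lam - (\<Sum>i<n. z i \<omega>)\<bar>) \<le> B"
    using ln_norm_S_mat_L1_close by blast
  then show ?thesis
    by (intro clt_of_L1_close_sums[OF asymp_variance_nonneg]) auto
qed

text \<open>Adding the coboundary equation to its reflection in the diagonal eliminates the potential.\<close>

lemma degenerate_imp_quadratic_relation:
  assumes "asymp_variance = 0"
  shows "AE s in law. AE t in law. (s + t)\<^sup>2 = exp (2 * lam) * \<bar>s * t\<bar>"
proof -
  let ?Q = "\<lambda>s t. ln \<bar>1 + t / s\<bar> - lam = potential s - potential t"
  have Q: "AE s in law. AE t in law. ?Q s t"
    using assms asymp_variance_eq_0_iff by simp
  have Q': "AE s in law. AE t in law. ?Q t s"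
    by (rule AE_swap_pair_law[OF _ Q]) measurable
  show ?thesis
    using Q Q' ratio_neq_law x_nonzero_AE
  proof eventually_elim
    case (elim s)
    show ?case
      using elim(1,2,3) x_nonzero_AE
    proof eventually_elim
      case (elim t)
      have nz: "s \<noteq> 0" "t \<noteq> 0" "s + t \<noteq> 0"
        using \<open>s \<noteq> 0\<close> elim by (auto simp: field_simps)
      have "ln \<bar>1 + t / s\<bar> = ln \<bar>s + t\<bar> - ln \<bar>s\<bar>" "ln \<bar>1 + s / t\<bar> = ln \<bar>s + t\<bar> - ln \<bar>t\<bar>"
        using nz ln_abs_one_plus_ratio[of s t] ln_abs_one_plus_ratio[of t s] by (simp_all add: add.commute)
      then have "2 * ln \<bar>s + t\<bar> = 2 * lam + ln \<bar>s\<bar> + ln \<bar>t\<bar>"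
        using elim(1,2) by linarith
      then have "exp (2 * ln \<bar>s + t\<bar>) = exp (2 * lam) * exp (ln \<bar>s\<bar>) * exp (ln \<bar>t\<bar>)"
        by (simp add: exp_add)
      then show ?case
        using nz by (simp add: exp_double abs_mult)
    qed
  qed
qed

text \<open>In logarithms the relation reads ln |1 + t/s| = ln 2 + (ln |t| - ln |s|) / 2, so the
  functional is a constant plus a coboundary of ln |s| / 2. The two logarithmic moments make this
  function integrable.\<close>

lemma quadratic_relation_imp_degenerate:
  assumes rel: "AE s in law. AE t in law. (s + t)\<^sup>2 = 4 * \<bar>s * t\<bar>"
  shows "asymp_variance = 0"
proof (rule asymp_variance_eq_0_if_coboundary)
  show "integrable law (\<lambda>s. ln \<bar>s\<bar> / 2)"
  proof -
    have "integrable M (\<lambda>\<omega>. ln \<bar>x (Suc 0) \<omega>\<bar>)"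
    proof (rule Bochner_Integration.integrable_bound)
      show "integrable M (\<lambda>\<omega>. ln (1 + \<bar>x 1 \<omega>\<bar>) + ln (1 + 1 / \<bar>x 1 \<omega>\<bar>))"
        using ln_integrable by simp
      have "\<bar>ln u\<bar> \<le> ln (1 + u) + ln (1 + 1 / u)" if "0 < u" for u :: real
      proof -
        have "ln (1 / u) \<le> ln (1 + 1 / u)" "ln u \<le> ln (1 + u)"
          using that by (intro ln_mono; simp add: add_pos_pos)+
        moreover have "0 \<le> ln (1 + u)" "0 \<le> ln (1 + 1 / u)"
          using that by auto
        moreover have "ln (1 / u) = - ln u"
          using that by (simp add: ln_div)
        ultimately show ?thesis
          by linarith
      qed
      then show "AE \<omega> in M. norm (ln \<bar>x (Suc 0) \<omega>\<bar>) \<le> norm (ln (1 + \<bar>x 1 \<omega>\<bar>) + ln (1 + 1 / \<bar>x 1 \<omega>\<bar>))"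
        using nonzero[of _ 0] by (auto intro!: AE_I2 order.trans[OF _ abs_ge_self])
    qed measurable
    then show ?thesis
      by (subst integrable_law_iff[of _ 0]) simp_all
  qed
  show "AE s in law. AE t in law. ln \<bar>1 + t / s\<bar> - lam = (ln 2 - lam) + ln \<bar>t\<bar> / 2 - ln \<bar>s\<bar> / 2"
    using rel x_nonzero_AE
  proof eventually_elim
    case (elim s)
    show ?case
      using elim(1) x_nonzero_AE
    proof eventually_elim
      case (elim t)
      have nz: "s \<noteq> 0" "t \<noteq> 0"
        using \<open>s \<noteq> 0\<close> elim by auto
      \<comment> \<open>Otherwise the relation would force s * t = 0.\<close>
      have "s + t \<noteq> 0"
        using elim nz by auto
      have "2 * ln \<bar>s + t\<bar> = ln (\<bar>s + t\<bar>\<^sup>2)"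
        using \<open>s + t \<noteq> 0\<close> by (subst ln_realpow) simp_all
      also have "\<bar>s + t\<bar>\<^sup>2 = 2\<^sup>2 * \<bar>s\<bar> * \<bar>t\<bar>"
        using elim(1) by (simp add: abs_mult)
      also have "ln (2\<^sup>2 * \<bar>s\<bar> * \<bar>t\<bar>) = ln (2\<^sup>2) + ln \<bar>s\<bar> + ln \<bar>t\<bar>"
        using nz by (simp add: ln_mult)
      also have "ln (2\<^sup>2 :: real) = 2 * ln 2"
        by (subst ln_realpow) simp_all
      finally show ?case
        using ln_abs_one_plus_ratio[of s t] nz \<open>s + t \<noteq> 0\<close> by simp
    qed
  qed
qed

lemma asymp_variance_eq_0_iff_atoms:
  "asymp_variance = 0 \<longleftrightarrow> (\<exists>a. a \<noteq> 0 \<and> (measure law {a} = 1 \<or>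
    (\<exists>r\<in>{-3 - 2 * sqrt 2, -3 + 2 * sqrt 2}. 0 < measure law {a} \<and> measure law {a} < 1 \<and>
      measure law {a} + measure law {r * a} = 1)))"
proof
  assume "asymp_variance = 0"
  then show "\<exists>a. a \<noteq> 0 \<and> (measure law {a} = 1 \<or>
    (\<exists>r\<in>{-3 - 2 * sqrt 2, -3 + 2 * sqrt 2}. 0 < measure law {a} \<and> measure law {a} < 1 \<and>
      measure law {a} + measure law {r * a} = 1))"
    by (rule atoms_of_quadratic_relation[OF prob_space_law sets_law x_nonzero_AE
          degenerate_imp_quadratic_relation])
next
  assume "\<exists>a. a \<noteq> 0 \<and> (measure law {a} = 1 \<or>
    (\<exists>r\<in>{-3 - 2 * sqrt 2, -3 + 2 * sqrt 2}. 0 < measure law {a} \<and> measure law {a} < 1 \<and>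
      measure law {a} + measure law {r * a} = 1))"
  then obtain a r where "a \<noteq> 0" "measure law {a} = 1 \<or>
      r \<in> {-3 - 2 * sqrt 2, -3 + 2 * sqrt 2} \<and> measure law {a} + measure law {r * a} = 1"
    by blast
  then show "asymp_variance = 0"
    by (intro quadratic_relation_imp_degenerate quadratic_relation_of_atoms[OF prob_space_law sets_law])
qed

end

section \<open>The limit theorem for the sequence indexed from 1\<close>

theorem theorem2:
  fixes M :: "'a measure"
    and x :: "nat \<Rightarrow> 'a \<Rightarrow> real"
    and N :: "real^2^2 \<Rightarrow> real"
  assumes "prob_space M"
    and indep: "prob_space.indep_vars M (\<lambda>_. borel) x {1..}"
    and ident: "\<forall>j\<ge>1. distr M borel (x j) = distr M borel (x 1)"
    and nonzero: "\<forall>j\<ge>1. \<forall>\<omega>\<in>space M. x j \<omega> \<noteq> 0"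
    and "integrable M (\<lambda>\<omega>. ln (1 + \<bar>x 1 \<omega>\<bar>))"
    and "integrable M (\<lambda>\<omega>. ln (1 + 1 / \<bar>x 1 \<omega>\<bar>))"
    and "(\<integral>\<^sup>+\<omega>. e2ennreal ((elog \<bar>1 + x 2 \<omega> / x 1 \<omega>\<bar>)\<^sup>2) \<partial>M) < \<infinity>"
    and "is_matrix_norm N"
  shows
    \<comment> \<open>the first conjunct: the expectations and the limit exist, and the variance is admissible\<close>
    "((\<forall>n\<ge>1. integrable M (\<lambda>\<omega>. ln (N (S_mat x n \<omega>)))) \<and>
      convergent (mean_log_growth M N x) \<and>
      integrable M (\<lambda>\<omega>. ln \<bar>1 + x 2 \<omega> / x 1 \<omega>\<bar> * ln \<bar>1 + x 3 \<omega> / x 2 \<omega>\<bar>) \<and>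
      0 \<le> asymp_var M N x) \<and>
     weak_conv_m
      (\<lambda>n. distr M borel
         (\<lambda>\<omega>. 1 / sqrt (real n) * (ln (N (S_mat x n \<omega>)) - real n * lyapunov_exponent M N x)))
      (centered_gaussian (asymp_var M N x)) \<and>
     (asymp_var M N x = 0 \<longleftrightarrow>
      (\<exists>a p. a \<noteq> 0 \<and> 0 < p \<and> p < 1 \<and>
        ((\<forall>j\<ge>1. measure M {\<omega>\<in>space M. x j \<omega> = a} = 1) \<or>
         (\<forall>j\<ge>1. measure M {\<omega>\<in>space M. x j \<omega> = a} = p \<and>
                p = 1 - measure M {\<omega>\<in>space M. x j \<omega> = (-3 - 2 * sqrt 2) * a}) \<or>
         (\<forall>j\<ge>1. measure M {\<omega>\<in>space M. x j \<omega> = a} = p \<and>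
                p = 1 - measure M {\<omega>\<in>space M. x j \<omega> = (-3 + 2 * sqrt 2) * a}))))"
proof -
  interpret prob_space M by fact
  have x_meas: "x j \<in> borel_measurable M" if "1 \<le> j" for j
    using indep that by (auto simp: indep_vars_def)
  \<comment> \<open>Independence over \<open>{1..}\<close> is carried to all natural indices through
    the singleton windows \<open>{Suc j}\<close>.\<close>
  have "indep_vars (\<lambda>j. PiM {Suc j} (\<lambda>_. borel)) (\<lambda>j \<omega>. restrict (\<lambda>i. x i \<omega>) {Suc j}) UNIV"
    by (rule indep_vars_restrict[OF indep]) (auto simp: disjoint_family_on_def)
  from indep_vars_compose2[OF this, of "\<lambda>j f. f (Suc j)" "\<lambda>_. borel"]
  have indep': "indep_vars (\<lambda>_. borel) (\<lambda>j. x (Suc j)) UNIV"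
    by simp
  have [measurable]: "x 1 \<in> borel_measurable M" "x 2 \<in> borel_measurable M"
    using x_meas by auto
  have ratio: "AE \<omega> in M. 1 + x 2 \<omega> / x 1 \<omega> \<noteq> 0" "integrable M (\<lambda>\<omega>. (ln \<bar>1 + x 2 \<omega> / x 1 \<omega>\<bar>)\<^sup>2)"
    by (rule finite_elog_square[OF _ assms(7)]; measurable)+
  interpret random_matrix_product M x N
  proof
    show "distr M borel (x (Suc j)) = distr M borel (x (Suc 0))" for j
      using ident[rule_format, of "Suc j"] by simp
    show "x (Suc j) \<omega> \<noteq> 0" if "\<omega> \<in> space M" for \<omega> j
      using nonzero that by simp
  qed (fact indep' assms ratio)+
  have law_singleton: "measure law {b} = measure M {\<omega>\<in>space M. x j \<omega> = b}" if "1 \<le> j" for b j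
  proof -
    have "law = distr M borel (x j)"
      using distr_X[of "j - 1"] that by simp
    then show ?thesis
      using x_meas[OF that] by (simp add: measure_distr vimage_def Int_def conj_commute)
  qed
  have "asymp_variance = 0 \<longleftrightarrow> (\<exists>a p. a \<noteq> 0 \<and> 0 < p \<and> p < 1 \<and>
        (measure law {a} = 1 \<or>
         (measure law {a} = p \<and> p = 1 - measure law {(-3 - 2 * sqrt 2) * a}) \<or>
         (measure law {a} = p \<and> p = 1 - measure law {(-3 + 2 * sqrt 2) * a})))"
    (is "_ \<longleftrightarrow> ?forms")
  proof -
    have "(\<exists>p. 0 < p \<and> p < 1 \<and> (A = 1 \<or> (A = p \<and> p = 1 - B) \<or> (A = p \<and> p = 1 - C)))
      \<longleftrightarrow> A = 1 \<or> (0 < A \<and> A < 1 \<and> A + B = 1) \<or> (0 < A \<and> A < 1 \<and> A + C = 1)" for A B C :: real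
    proof
      assume "A = 1 \<or> (0 < A \<and> A < 1 \<and> A + B = 1) \<or> (0 < A \<and> A < 1 \<and> A + C = 1)"
      \<comment> \<open>The witness for p is 1/2 in form (i), which leaves p free, and A itself in
        the other two.\<close>
      then show "\<exists>p. 0 < p \<and> p < 1 \<and> (A = 1 \<or> (A = p \<and> p = 1 - B) \<or> (A = p \<and> p = 1 - C))"
        by (cases "A = 1") (auto intro: exI[of _ "1 / 2 :: real"] exI[of _ A])
    qed auto
    then show ?thesis
      unfolding asymp_variance_eq_0_iff_atoms by (simp only: bex_simps ex_simps insert_iff) auto
  qed
  moreover have "?forms \<longleftrightarrow> (\<exists>a p. a \<noteq> 0 \<and> 0 < p \<and> p < 1 \<and>
        ((\<forall>j\<ge>1. measure M {\<omega>\<in>space M. x j \<omega> = a} = 1) \<or>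
         (\<forall>j\<ge>1. measure M {\<omega>\<in>space M. x j \<omega> = a} = p \<and>
                p = 1 - measure M {\<omega>\<in>space M. x j \<omega> = (-3 - 2 * sqrt 2) * a}) \<or>
         (\<forall>j\<ge>1. measure M {\<omega>\<in>space M. x j \<omega> = a} = p \<and>
                p = 1 - measure M {\<omega>\<in>space M. x j \<omega> = (-3 + 2 * sqrt 2) * a})))"
  proof -
    \<comment> \<open>All \<open>x j\<close> have the law \<open>law\<close>, so the conditions
      under the bounded quantifiers are constant in j; the quantifiers drop because some j >= 1
      exists.\<close>
    have "Ex ((\<le>) (Suc 0))"
      by (rule exI[of _ "Suc 0"]) simp
    then show ?thesis
      by (simp add: law_singleton[symmetric] cong: conj_cong)
  qed
  moreover have "weak_conv_m
      (\<lambda>n. distr M borel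
         (\<lambda>\<omega>. 1 / sqrt (real n) * (ln (N (S_mat x n \<omega>)) - real n * lyapunov_exponent M N x)))
      (centered_gaussian (asymp_var M N x))"
    using clt_ln_norm_S_mat by (simp add: lyapunov_exponent_eq asymp_var_eq)
  ultimately show ?thesis
    using ln_norm_S_mat_integrable mean_log_growth_tendsto ratio_mult(1) asymp_variance_nonneg
    unfolding asymp_var_eq by (auto simp only: convergent_def)
qed

end
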